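(* Let $D$ be a (possibly unbounded) self-adjoint operator on a Hilbert space $H$, let $n\geq 1$ be a natural number and let $a\in B(H)$ be $(n+1)$-times weakly $D$-differentiable. Then $a$ is $n$-times uniformly $D$-differentiable.
   Context: $B(H)$ is the algebra of bounded operators on $H$ with operator norm $\|\cdot\|$. For $t\in\mathbb{R}$ and $a\in B(H)$ let $\alpha_t(a):=e^{itD}ae^{-itD}$. An operator $a\in B(H)$ is weakly $D$-differentiable if there is a bounded operator $b$ on $H$ with $\lim_{t\to0}|\langle(\frac{\alpha_t(a)-a}{t}-b)\xi,\eta\rangle|=0$ for all $\xi,\eta\in H$; then $b$ is denoted $\delta_w^D(a)$. It is uniformly $D$-differentiable if there is a bounded operator $b$ on $H$ with $\lim_{t\to0}\|\frac{\alpha_t(a)-a}{t}-b\|=0$; then $b$ is denoted $\delta_u^D(a)$. For a natural number $k$, $a$ is $k$-times weakly (respectively uniformly) $D$-differentiable if $a$ belongs to the domain of the $k$-th power $(\delta_w^D)^k$ (respectively $(\delta_u^D)^k$), i.e. if $a, \delta(a),\dots,\delta^{k-1}(a)$ are all weakly (respectively uniformly) $D$-differentiable, where $\delta=\delta_w^D$ (respectively $\delta=\delta_u^D$). *)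

theory Defs
  imports "HOL-Analysis.Analysis"
begin

text \<open>
  Complex Hilbert spaces, as complex Banach spaces whose norm is induced by an inner product
  that is linear in its first argument. Positive definiteness of \<open>cinner\<close> is contained in
  \<open>cinner_self\<close>, since \<open>norm\<close> is already a norm.
\<close>

class chilbert_space = banach +
  fixes scaleC :: "complex \<Rightarrow> 'a \<Rightarrow> 'a" (infixr \<open>*\<^sub>C\<close> 75)
    and cinner :: "'a \<Rightarrow> 'a \<Rightarrow> complex"
  assumes scaleC_of_real: "complex_of_real r *\<^sub>C x = r *\<^sub>R x"
    and scaleC_add_right: "c *\<^sub>C (x + y) = c *\<^sub>C x + c *\<^sub>C y"
    and scaleC_add_left: "(c + d) *\<^sub>C x = c *\<^sub>C x + d *\<^sub>C x"
    and scaleC_scaleC: "c *\<^sub>C d *\<^sub>C x = (c * d) *\<^sub>C x"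
    and cinner_commute: "cinner x y = cnj (cinner y x)"
    and cinner_add_left: "cinner (x + y) z = cinner x z + cinner y z"
    and cinner_scaleC_left: "cinner (c *\<^sub>C x) y = c * cinner x y"
    and cinner_self: "cinner x x = complex_of_real ((norm x)\<^sup>2)"

text \<open>
  The library type of bounded operators only asks for real linearity, so the algebra of bounded
  operators on a complex Hilbert space is a subset of it; its norm is the operator norm.
\<close>

definition bounded_ops :: "('a::chilbert_space \<Rightarrow>\<^sub>L 'a) set" where
  "bounded_ops = {a. \<forall>c \<xi>. blinfun_apply a (c *\<^sub>C \<xi>) = c *\<^sub>C blinfun_apply a \<xi>}"

definition unitary_op :: "('a::chilbert_space \<Rightarrow>\<^sub>L 'a) \<Rightarrow> bool" where
  "unitary_op u \<longleftrightarrow> u \<in> bounded_ops \<and> surj (blinfun_apply u) \<and>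
     (\<forall>\<xi> \<eta>. cinner (blinfun_apply u \<xi>) (blinfun_apply u \<eta>) = cinner \<xi> \<eta>)"

text \<open>
  A possibly unbounded operator is identified with its graph: \<open>(\<xi>, \<phi>) \<in> T\<close> means that
  \<open>\<xi>\<close> is in the domain of \<open>T\<close> and \<open>T \<xi> = \<phi>\<close>.
\<close>

definition densely_defined_op :: "('a::chilbert_space \<times> 'a) set \<Rightarrow> bool" where
  "densely_defined_op T \<longleftrightarrow> single_valued T \<and> closure (Domain T) = UNIV \<and>
     (\<forall>\<xi> \<phi> \<xi>' \<phi>'. (\<xi>, \<phi>) \<in> T \<longrightarrow> (\<xi>', \<phi>') \<in> T \<longrightarrow> (\<xi> + \<xi>', \<phi> + \<phi>') \<in> T) \<and>
     (\<forall>c \<xi> \<phi>. (\<xi>, \<phi>) \<in> T \<longrightarrow> (c *\<^sub>C \<xi>, c *\<^sub>C \<phi>) \<in> T)"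

definition op_adjoint :: "('a::chilbert_space \<times> 'a) set \<Rightarrow> ('a \<times> 'a) set" where
  "op_adjoint T = {(\<eta>, \<zeta>). \<forall>(\<xi>, \<phi>)\<in>T. cinner \<phi> \<eta> = cinner \<xi> \<zeta>}"

definition self_adjoint :: "('a::chilbert_space \<times> 'a) set \<Rightarrow> bool" where
  "self_adjoint D \<longleftrightarrow> densely_defined_op D \<and> op_adjoint D = D"

definition unitary_group :: "(real \<Rightarrow> ('a::chilbert_space \<Rightarrow>\<^sub>L 'a)) \<Rightarrow> bool" where
  "unitary_group U \<longleftrightarrow> (\<forall>t. unitary_op (U t)) \<and> U 0 = id_blinfun \<and>
     (\<forall>s t. U (s + t) = U s o\<^sub>L U t) \<and>
     (\<forall>\<xi>. continuous_on UNIV (\<lambda>t. blinfun_apply (U t) \<xi>))"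

definition generator :: "(real \<Rightarrow> ('a::chilbert_space \<Rightarrow>\<^sub>L 'a)) \<Rightarrow> ('a \<times> 'a) set" where
  "generator U = {(\<xi>, \<phi>). ((\<lambda>t. (1 / t) *\<^sub>R (blinfun_apply (U t) \<xi> - \<xi>)) \<longlongrightarrow> \<phi>) (at 0)}"

text \<open>
  \<open>exp_group D t\<close> is \<open>exp (i t D)\<close>: by Stone's theorem, for self-adjoint \<open>D\<close> there is exactly one
  strongly continuous one-parameter unitary group whose infinitesimal generator is \<open>i D\<close>
  (with equality of domains).
\<close>

definition exp_group :: "('a::chilbert_space \<times> 'a) set \<Rightarrow> real \<Rightarrow> ('a \<Rightarrow>\<^sub>L 'a)" where
  "exp_group D = (THE U. unitary_group U \<and> generator U = {(\<xi>, \<i> *\<^sub>C \<phi>) | \<xi> \<phi>. (\<xi>, \<phi>) \<in> D})"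

definition alpha :: "('a::chilbert_space \<times> 'a) set \<Rightarrow> real \<Rightarrow> ('a \<Rightarrow>\<^sub>L 'a) \<Rightarrow> ('a \<Rightarrow>\<^sub>L 'a)" where
  "alpha D t a = exp_group D t o\<^sub>L a o\<^sub>L exp_group D (- t)"

definition has_weak_D_derivative ::
  "('a::chilbert_space \<times> 'a) set \<Rightarrow> ('a \<Rightarrow>\<^sub>L 'a) \<Rightarrow> ('a \<Rightarrow>\<^sub>L 'a) \<Rightarrow> bool" where
  "has_weak_D_derivative D a b \<longleftrightarrow> b \<in> bounded_ops \<and>
     (\<forall>\<xi> \<eta>. ((\<lambda>t. cmod (cinner (blinfun_apply ((1 / t) *\<^sub>R (alpha D t a - a) - b) \<xi>) \<eta>)) \<longlongrightarrow> 0) (at 0))"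

definition has_uniform_D_derivative ::
  "('a::chilbert_space \<times> 'a) set \<Rightarrow> ('a \<Rightarrow>\<^sub>L 'a) \<Rightarrow> ('a \<Rightarrow>\<^sub>L 'a) \<Rightarrow> bool" where
  "has_uniform_D_derivative D a b \<longleftrightarrow> b \<in> bounded_ops \<and>
     ((\<lambda>t. norm ((1 / t) *\<^sub>R (alpha D t a - a) - b)) \<longlongrightarrow> 0) (at 0)"

definition weakly_D_differentiable ::
  "('a::chilbert_space \<times> 'a) set \<Rightarrow> ('a \<Rightarrow>\<^sub>L 'a) \<Rightarrow> bool" where
  "weakly_D_differentiable D a \<longleftrightarrow> a \<in> bounded_ops \<and> (\<exists>b. has_weak_D_derivative D a b)"

definition uniformly_D_differentiable ::
  "('a::chilbert_space \<times> 'a) set \<Rightarrow> ('a \<Rightarrow>\<^sub>L 'a) \<Rightarrow> bool" where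
  "uniformly_D_differentiable D a \<longleftrightarrow> a \<in> bounded_ops \<and> (\<exists>b. has_uniform_D_derivative D a b)"

definition delta_w :: "('a::chilbert_space \<times> 'a) set \<Rightarrow> ('a \<Rightarrow>\<^sub>L 'a) \<Rightarrow> ('a \<Rightarrow>\<^sub>L 'a)" where
  "delta_w D a = (THE b. has_weak_D_derivative D a b)"

definition delta_u :: "('a::chilbert_space \<times> 'a) set \<Rightarrow> ('a \<Rightarrow>\<^sub>L 'a) \<Rightarrow> ('a \<Rightarrow>\<^sub>L 'a)" where
  "delta_u D a = (THE b. has_uniform_D_derivative D a b)"

definition times_weakly_D_differentiable ::
  "nat \<Rightarrow> ('a::chilbert_space \<times> 'a) set \<Rightarrow> ('a \<Rightarrow>\<^sub>L 'a) \<Rightarrow> bool" where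
  "times_weakly_D_differentiable k D a \<longleftrightarrow>
     (\<forall>j<k. weakly_D_differentiable D ((delta_w D ^^ j) a))"

definition times_uniformly_D_differentiable ::
  "nat \<Rightarrow> ('a::chilbert_space \<times> 'a) set \<Rightarrow> ('a \<Rightarrow>\<^sub>L 'a) \<Rightarrow> bool" where
  "times_uniformly_D_differentiable k D a \<longleftrightarrow>
     (\<forall>j<k. uniformly_D_differentiable D ((delta_u D ^^ j) a))"

end

theory Submission
  imports Defs
begin

text \<open>
  If \<open>b\<close> is a weak derivative of \<open>a\<close> and \<open>c\<close> is one of \<open>b\<close>, then for fixed \<open>\<xi>\<close>, \<open>\<eta>\<close> the function
  \<open>t \<mapsto> \<langle>\<alpha>\<^sub>t(a) \<xi>, \<eta>\<rangle>\<close> is differentiable at every \<open>t\<close> with derivative \<open>\<langle>\<alpha>\<^sub>t(b) \<xi>, \<eta>\<rangle>\<close>, because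
  \<open>\<alpha>\<^sub>t\<^sub>+\<^sub>h = \<alpha>\<^sub>t \<alpha>\<^sub>h\<close> and \<open>exp (i t D)\<close> is unitary; likewise for \<open>b\<close> and \<open>c\<close>. The mean value inequality,
  applied first to \<open>b\<close> and then to \<open>a\<close>, gives \<open>\<parallel>\<alpha>\<^sub>t(b) - b\<parallel> \<le> \<parallel>c\<parallel> \<bar>t\<bar>\<close> and
  \<open>\<parallel>\<alpha>\<^sub>t(a) - a - t b\<parallel> \<le> \<parallel>c\<parallel> t\<^sup>2\<close>, the norms being recovered by the supremum over \<open>\<xi>\<close> and \<open>\<eta>\<close>
  (\<open>norm_alpha_taylor_le\<close>). Division by \<open>t\<close> shows that \<open>b\<close> is the uniform derivative of \<open>a\<close>. One weak
  derivative is thus traded for uniformity of all the previous ones, which is the theorem by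
  induction on the order.

  This uses that \<open>exp (i t D)\<close> is a unitary group, which is Stone's theorem and takes most of the
  text (\<open>unitary_group_exp_group\<close>). The operator \<open>A = i D\<close> satisfies \<open>A\<^sup>* = - A\<close>, so
  \<open>\<parallel>x - \<mu> A x\<parallel>\<^sup>2 = \<parallel>x\<parallel>\<^sup>2 + \<mu>\<^sup>2 \<parallel>A x\<parallel>\<^sup>2\<close> for real \<open>\<mu>\<close>. Hence \<open>1 - \<mu> A\<close> has closed range, and the range is
  dense because a nonzero vector orthogonal to it would be an eigenvector of \<open>A\<close> with a nonzero real eigenvalue.
  The bounded operators \<open>A (1 - \<mu>\<^sup>2 A\<^sup>2)\<inverse>\<close> built from the resolvents are skew-symmetric, commute,
  and converge to \<open>A\<close> on its domain as \<open>\<mu> \<rightarrow> 0\<close>. Their exponentials are therefore unitary and,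
  by Duhamel's comparison (\<open>exp_flow_diff_le\<close>), converge strongly to a unitary group. Its generator
  extends \<open>A\<close> and is skew-symmetric, so it equals \<open>A\<close>. Uniqueness holds since
  the difference of two solutions of \<open>w' = A w\<close> has constant norm.
\<close>

section \<open>Geometry of complex Hilbert spaces\<close>

lemma scaleC_scaleR_right: "c *\<^sub>C r *\<^sub>R x = r *\<^sub>R c *\<^sub>C (x::'a::chilbert_space)"
proof -
  have "c *\<^sub>C r *\<^sub>R x = c *\<^sub>C complex_of_real r *\<^sub>C x"
    by (simp only: scaleC_of_real)
  also have "\<dots> = complex_of_real r *\<^sub>C c *\<^sub>C x"
    by (simp only: scaleC_scaleC mult.commute)
  finally show ?thesis by (simp only: scaleC_of_real)
qed

lemma norm_scaleC [simp]: "norm (c *\<^sub>C (x::'a::chilbert_space)) = cmod c * norm x"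
proof -
  have "complex_of_real ((norm (c *\<^sub>C x))\<^sup>2) = c * cinner x (c *\<^sub>C x)"
    by (simp only: cinner_self[symmetric] cinner_scaleC_left)
  also have "\<dots> = c * cnj (c * cinner x x)"
    by (simp only: cinner_commute[of x "c *\<^sub>C x"] cinner_scaleC_left)
  also have "\<dots> = complex_of_real ((cmod c * norm x)\<^sup>2)"
    unfolding cinner_self by (simp add: complex_norm_square[symmetric] power_mult_distrib)
  finally show ?thesis
    by (metis of_real_eq_iff power2_eq_imp_eq norm_ge_zero mult_nonneg_nonneg)
qed

lemma bounded_linear_scaleC: "bounded_linear (\<lambda>x::'a::chilbert_space. c *\<^sub>C x)"
  by (rule bounded_linear_intro[where K="cmod c"])
     (simp_all add: scaleC_add_right scaleC_scaleR_right)

lemmas scaleC_diff_right = linear_diff[OF bounded_linear.linear[OF bounded_linear_scaleC]]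
  and tendsto_scaleC = bounded_linear.tendsto[OF bounded_linear_scaleC]

lemma scaleC_one [simp]: "1 *\<^sub>C (x::'a::chilbert_space) = x"
  using scaleC_of_real[of 1 x] by simp

lemma scaleC_minus_one [simp]: "(-1) *\<^sub>C (x::'a::chilbert_space) = - x"
  using scaleC_of_real[of "-1" x] by simp

lemma cinner_add_right: "cinner x (y + z) = cinner x y + cinner (x::'a::chilbert_space) z"
  by (metis cinner_commute cinner_add_left complex_cnj_add)

lemma cinner_scaleC_right: "cinner x (c *\<^sub>C y) = cnj c * cinner (x::'a::chilbert_space) y"
  by (metis cinner_commute cinner_scaleC_left complex_cnj_mult)

lemma cinner_scaleR_left: "cinner (r *\<^sub>R x) y = r *\<^sub>R cinner (x::'a::chilbert_space) y"
  by (metis scaleC_of_real cinner_scaleC_left scaleR_conv_of_real)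

lemma cinner_scaleR_right: "cinner x (r *\<^sub>R y) = r *\<^sub>R cinner (x::'a::chilbert_space) y"
  by (metis scaleC_of_real cinner_scaleC_right complex_cnj_complex_of_real scaleR_conv_of_real)

lemma Re_cinner_commute: "Re (cinner x y) = Re (cinner (y::'a::chilbert_space) x)"
  by (metis cinner_commute complex_cnj(1) complex.exhaust_sel complex.sel(1))

lemma norm_add_sq:
  "(norm (x + y))\<^sup>2 = (norm x)\<^sup>2 + 2 * Re (cinner x y) + (norm (y::'a::chilbert_space))\<^sup>2"
proof -
  have "complex_of_real ((norm (x + y))\<^sup>2) = cinner x x + cinner x y + cinner y x + cinner y y"
    by (simp only: cinner_self[symmetric] cinner_add_left cinner_add_right add.assoc)
       (simp add: algebra_simps)
  then have "(norm (x + y))\<^sup>2 = Re (cinner x x + cinner x y + cinner y x + cinner y y)"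
    by (metis Re_complex_of_real)
  then show ?thesis
    by (simp add: cinner_self Re_cinner_commute[of y x])
qed

text \<open>
  The triangle inequality is among the axioms of a norm, so the bound on the real part is read
  off from it; a rotation by the phase of the inner product gives the bound on its modulus.
\<close>

lemma cinner_Cauchy_Schwarz: "cmod (cinner x y) \<le> norm x * norm (y::'a::chilbert_space)"
proof -
  have re: "Re (cinner u v) \<le> norm u * norm v" for u v :: 'a
  proof -
    have "(norm (u + v))\<^sup>2 \<le> (norm u + norm v)\<^sup>2"
      by (intro power_mono norm_triangle_ineq) auto
    then show ?thesis by (simp add: norm_add_sq power2_sum)
  qed
  show ?thesis
  proof (cases "cinner x y = 0")
    case False
    define c where "c = cnj (cinner x y) / cmod (cinner x y)"
    have "cmod c = 1" using False by (simp add: c_def norm_divide)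
    moreover have "c * cinner x y = cmod (cinner x y)"
      using False by (simp add: c_def mult.commute[of "cnj _"] complex_norm_square[symmetric] power2_eq_square)
    ultimately show ?thesis
      using re[of "c *\<^sub>C x" y] by (simp add: cinner_scaleC_left)
  qed simp
qed

lemma bounded_bilinear_cinner: "bounded_bilinear (cinner :: 'a::chilbert_space \<Rightarrow> 'a \<Rightarrow> complex)"
proof
  show "\<exists>K. \<forall>a b. norm (cinner a (b::'a)) \<le> norm a * norm b * K"
    by (rule exI[of _ 1]) (simp add: cinner_Cauchy_Schwarz)
qed (simp_all add: cinner_add_left cinner_add_right cinner_scaleR_left cinner_scaleR_right)

interpretation cinner: bounded_bilinear "cinner :: 'a::chilbert_space \<Rightarrow> 'a \<Rightarrow> complex"
  by (rule bounded_bilinear_cinner)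

lemma parallelogram:
  "(norm (x - y))\<^sup>2 = 2 * (norm x)\<^sup>2 + 2 * (norm y)\<^sup>2 - (norm (x + (y::'a::chilbert_space)))\<^sup>2"
  using norm_add_sq[of x y] norm_add_sq[of x "- y"] by (simp add: cinner.minus_right)

text \<open>
  The orthogonal vector is the difference of a point outside \<open>M\<close> and its nearest point in \<open>M\<close>.
  By the parallelogram law a sequence in \<open>M\<close> whose distances to the point approach the infimum is
  a Cauchy sequence, so the nearest point exists by completeness.
\<close>

lemma exists_orthogonal_vector:
  fixes M :: "'a::chilbert_space set"
  assumes "closed M" "M \<noteq> UNIV"
    and zero: "0 \<in> M"
    and add: "\<And>x y. x \<in> M \<Longrightarrow> y \<in> M \<Longrightarrow> x + y \<in> M"
    and scale: "\<And>c x. x \<in> M \<Longrightarrow> c *\<^sub>C x \<in> M"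
  obtains y where "y \<noteq> 0" "\<And>m. m \<in> M \<Longrightarrow> cinner m y = 0"
proof -
  obtain z where z: "z \<notin> M" using assms(2) by blast
  have scaleR: "r *\<^sub>R x \<in> M" if "x \<in> M" for r x
    using scale[OF that, of "complex_of_real r"] by (simp add: scaleC_of_real)
  define d where "d = infdist z M"
  have d: "d \<le> norm (z - m)" if "m \<in> M" for m
    using infdist_le[OF that, of z] by (simp add: d_def dist_norm)
  have "0 \<le> d" by (simp add: d_def infdist_nonneg)
  have "\<exists>m\<in>M. (norm (z - m))\<^sup>2 < d\<^sup>2 + 1 / Suc k" for k
  proof -
    have "d < sqrt (d\<^sup>2 + 1 / Suc k)"
      by (rule real_less_rsqrt) simp
    moreover have "d = Inf (dist z ` M)" "dist z ` M \<noteq> {}"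
      using zero infdist_notempty[of M z] by (auto simp: d_def)
    ultimately obtain m where m: "m \<in> M" "dist z m < sqrt (d\<^sup>2 + 1 / Suc k)"
      using cInf_lessD[of "dist z ` M" "sqrt (d\<^sup>2 + 1 / Suc k)"] by (metis imageE)
    have "(norm (z - m))\<^sup>2 < (sqrt (d\<^sup>2 + 1 / Suc k))\<^sup>2"
      using m by (intro power_strict_mono) (auto simp: dist_norm)
    then show ?thesis using m(1) by (intro bexI[of _ m]) auto
  qed
  then obtain m where mM: "\<And>k. m k \<in> M"
    and m: "\<And>k. (norm (z - m k))\<^sup>2 < d\<^sup>2 + 1 / Suc k" by metis
  have close: "(norm (m j - m k))\<^sup>2 \<le> 2 / Suc j + 2 / Suc k" for j k
  proof -
    have "d \<le> norm (z - (1/2) *\<^sub>R (m j + m k))"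
      by (intro d scaleR add mM)
    also have "\<dots> = norm ((z - m j) + (z - m k)) / 2"
    proof -
      have "z - (1/2) *\<^sub>R (m j + m k) = (1/2) *\<^sub>R ((z - m j) + (z - m k))"
        by (simp add: algebra_simps flip: scaleR_add_left)
      then show ?thesis by simp
    qed
    finally have "(2 * d)\<^sup>2 \<le> (norm ((z - m j) + (z - m k)))\<^sup>2"
      using \<open>0 \<le> d\<close> by (intro power_mono) auto
    then show ?thesis
      using parallelogram[of "z - m j" "z - m k"] m[of j] m[of k]
      by (simp add: power_mult_distrib norm_minus_commute)
  qed
  have "Cauchy m"
  proof (rule metric_CauchyI)
    fix e :: real assume "0 < e"
    then obtain N where N: "4 / e\<^sup>2 < real (Suc N)"
      by (metis reals_Archimedean2 less_Suc_eq of_nat_less_iff less_trans)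
    have "dist (m j) (m k) < e" if "j \<ge> N" "k \<ge> N" for j k
    proof -
      have "2 / Suc j \<le> 2 / Suc N" "2 / Suc k \<le> 2 / Suc N"
        using that by (auto intro!: divide_left_mono)
      with close[of j k] have "(norm (m j - m k))\<^sup>2 \<le> 4 / Suc N" by simp
      also have "\<dots> < e\<^sup>2" using N \<open>0 < e\<close> by (simp add: field_simps)
      finally show ?thesis using \<open>0 < e\<close> by (auto simp: dist_norm intro: power2_less_imp_less)
    qed
    then show "\<exists>N. \<forall>j\<ge>N. \<forall>k\<ge>N. dist (m j) (m k) < e" by blast
  qed
  then obtain p where p: "m \<longlonglongrightarrow> p" by (auto simp: Cauchy_convergent_iff convergent_def)
  have pM: "p \<in> M" using \<open>closed M\<close> mM p closed_sequentially by blast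
  define y where "y = z - p"
  have "(norm y)\<^sup>2 \<le> d\<^sup>2 + 0"
  proof (rule LIMSEQ_le)
    show "(\<lambda>k. (norm (z - m k))\<^sup>2) \<longlonglongrightarrow> (norm y)\<^sup>2"
      unfolding y_def by (intro tendsto_intros p)
    show "(\<lambda>k. d\<^sup>2 + 1 / real (Suc k)) \<longlonglongrightarrow> d\<^sup>2 + 0"
      by (intro tendsto_intros LIMSEQ_Suc lim_1_over_n)
  qed (use m in \<open>auto intro: less_imp_le\<close>)
  then have yd: "norm y \<le> d" using \<open>0 \<le> d\<close> by (auto intro: power2_le_imp_le)
  have min: "(norm y)\<^sup>2 \<le> (norm (y + x))\<^sup>2" if "x \<in> M" for x
  proof -
    have "p + (-1) *\<^sub>C x \<in> M" by (intro add scale pM that)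
    from d[OF this] have "d \<le> norm (y + x)" by (simp add: y_def algebra_simps)
    with yd show ?thesis by (intro power_mono) auto
  qed
  have re: "Re (cinner y x) = 0" if "x \<in> M" for x
  proof (rule ccontr)
    assume nz: "Re (cinner y x) \<noteq> 0"
    then have "x \<noteq> 0" by (auto simp: cinner.zero_right)
    \<comment> \<open>the minimum point of the quadratic function \<open>r \<mapsto> \<parallel>y + r x\<parallel>\<^sup>2\<close>\<close>
    define r where "r = - Re (cinner y x) / (norm x)\<^sup>2"
    have "0 \<le> 2 * r * Re (cinner y x) + r\<^sup>2 * (norm x)\<^sup>2"
      using min[OF scaleR[OF that, of r]]
      by (simp add: norm_add_sq cinner_scaleR_right power_mult_distrib)
    also have "\<dots> = - (Re (cinner y x))\<^sup>2 / (norm x)\<^sup>2"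
      using \<open>x \<noteq> 0\<close> by (simp add: r_def field_simps power2_eq_square)
    also have "\<dots> < 0" using nz \<open>x \<noteq> 0\<close> by (simp add: divide_neg_pos)
    finally show False by simp
  qed
  have "cinner x y = 0" if "x \<in> M" for x
  proof -
    have "Re (cinner x y) = 0" using re[OF that] Re_cinner_commute by metis
    \<comment> \<open>the imaginary part of \<open>\<langle>x, y\<rangle>\<close>, up to sign\<close>
    moreover have "Re (cinner (\<i> *\<^sub>C x) y) = 0"
      using re[OF scale[OF that]] Re_cinner_commute by metis
    ultimately show ?thesis by (simp add: cinner_scaleC_left complex_eq_iff)
  qed
  moreover have "y \<noteq> 0" using z pM by (auto simp: y_def)
  ultimately show ?thesis using that by blast
qed

text \<open>
  A differentiable curve whose velocity is always orthogonal to it, for the real inner product,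
  stays on a sphere. It gives uniqueness for every skew-symmetric evolution equation below.
\<close>

lemma norm_constant_of_skew_derivative:
  fixes w :: "real \<Rightarrow> 'a::chilbert_space"
  assumes "\<And>t. (w has_vector_derivative w' t) (at t)" "\<And>t. Re (cinner (w' t) (w t)) = 0"
  shows "norm (w t) = norm (w 0)"
proof -
  have "((\<lambda>s. Re (cinner (w s) (w s))) has_vector_derivative 0) (at s)" for s
  proof -
    have "((\<lambda>s. Re (cinner (w s) (w s))) has_vector_derivative
            Re (cinner (w s) (w' s) + cinner (w' s) (w s))) (at s)"
      by (intro bounded_linear.has_vector_derivative[OF bounded_linear_Re]
          cinner.has_vector_derivative assms)
    then show ?thesis using assms(2)[of s] by (simp add: Re_cinner_commute[of "w s"])
  qed
  then obtain c where "\<And>s. Re (cinner (w s) (w s)) = c"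
    using has_vector_derivative_zero_constant[of UNIV "\<lambda>s. Re (cinner (w s) (w s))"] by auto
  then have "(norm (w t))\<^sup>2 = (norm (w 0))\<^sup>2"
    by (metis cinner_self Re_complex_of_real)
  then show ?thesis by simp
qed

lemma vector_derivative_bound:
  fixes f :: "real \<Rightarrow> 'b::real_normed_vector"
  assumes "\<And>s. (f has_vector_derivative f' s) (at s)"
    and "\<And>s. \<bar>s\<bar> \<le> \<bar>t\<bar> \<Longrightarrow> norm (f' s) \<le> C"
  shows "norm (f t - f 0) \<le> C * \<bar>t\<bar>"
proof -
  have "norm (f t - f 0) \<le> C * norm (t - 0)"
  proof (rule differentiable_bound[where S="{- \<bar>t\<bar> .. \<bar>t\<bar>}"])
    show "(f has_derivative (\<lambda>h. h *\<^sub>R f' s)) (at s within {- \<bar>t\<bar>..\<bar>t\<bar>})" for s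
      using assms(1) has_derivative_at_withinI unfolding has_vector_derivative_def by blast
    show "onorm (\<lambda>h::real. h *\<^sub>R f' s) \<le> C" if "s \<in> {- \<bar>t\<bar>..\<bar>t\<bar>}" for s
    proof (rule onorm_le)
      have "norm (f' s) \<le> C" using assms(2)[of s] that by (simp add: abs_le_iff)
      then have "\<bar>h\<bar> * norm (f' s) \<le> \<bar>h\<bar> * C" for h by (rule mult_left_mono) simp
      then show "norm (h *\<^sub>R f' s) \<le> C * norm h" for h by (simp add: mult.commute)
    qed
  qed (auto simp: abs_le_iff)
  then show ?thesis by simp
qed

section \<open>Skew-adjoint operators and their resolvents\<close>

text \<open>
  The generator of \<open>exp (i t D)\<close> is \<open>A = i D\<close>, and \<open>A\<^sup>* = - A\<close>. The single equivalence \<open>adjoint\<close>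
  expresses this equality of graphs, and it already makes the graph a closed linear
  subspace.
\<close>

locale skew_adjoint =
  fixes A :: "('a::chilbert_space \<times> 'a) set"
  assumes dense: "closure (Domain A) = UNIV"
    and adjoint: "(y, v) \<in> A \<longleftrightarrow> (\<forall>(x, u)\<in>A. cinner u y = - cinner x v)"
begin

lemma skew: "(x, u) \<in> A \<Longrightarrow> (y, v) \<in> A \<Longrightarrow> cinner u y = - cinner x v"
  using adjoint[of y v] by blast

lemma graph_add:
  assumes "(x, u) \<in> A" "(y, v) \<in> A"
  shows "(x + y, u + v) \<in> A"
  unfolding adjoint using skew[OF _ assms(1)] skew[OF _ assms(2)]
  by (auto simp: cinner.add_right)

lemma graph_scaleC:
  assumes "(x, u) \<in> A"
  shows "(c *\<^sub>C x, c *\<^sub>C u) \<in> A"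
  unfolding adjoint using skew[OF _ assms] by (auto simp: cinner_scaleC_right)

lemma graph_scaleR:
  assumes "(x, u) \<in> A"
  shows "(r *\<^sub>R x, r *\<^sub>R u) \<in> A"
  using graph_scaleC[OF assms, of "complex_of_real r"] by (simp add: scaleC_of_real)

lemma graph_zero: "(0, 0) \<in> A"
  unfolding adjoint by (simp add: cinner.zero_right)

lemma graph_diff: "(x, u) \<in> A \<Longrightarrow> (y, v) \<in> A \<Longrightarrow> (x - y, u - v) \<in> A"
  using graph_add[of x u "- y" "- v"] graph_scaleR[of y v "-1"] by simp

lemma graph_closed:
  assumes "\<And>n. (x n, u n) \<in> A" "x \<longlonglongrightarrow> y" "u \<longlonglongrightarrow> v"
  shows "(y, v) \<in> A"
  unfolding adjoint
proof clarify
  fix a b assume "(a, b) \<in> A"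
  then have "(\<lambda>n. cinner b (x n)) = (\<lambda>n. - cinner a (u n))"
    using skew assms(1) by blast
  moreover have "(\<lambda>n. cinner b (x n)) \<longlonglongrightarrow> cinner b y" "(\<lambda>n. - cinner a (u n)) \<longlonglongrightarrow> - cinner a v"
    by (intro tendsto_intros cinner.tendsto assms)+
  ultimately show "cinner b y = - cinner a v"
    using LIMSEQ_unique by metis
qed

lemma Re_cinner_graph: "(x, u) \<in> A \<Longrightarrow> Re (cinner u x) = 0"
  using skew[of x u x u] Re_cinner_commute[of x u] by simp

lemma approx:
  assumes "0 < e"
  obtains y v where "(y, v) \<in> A" "norm (x - y) < e"
proof -
  have "x \<in> closure (Domain A)" by (simp add: dense)
  then obtain y where "y \<in> Domain A" "dist y x < e"
    using assms unfolding closure_approachable by blast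
  then show ?thesis using that by (auto simp: dist_norm norm_minus_commute)
qed

text \<open>The orthogonality of the two terms is what makes resolvents on the real axis contractive.\<close>

lemma norm_resolvent_sq:
  assumes "(x, u) \<in> A"
  shows "(norm (x - \<mu> *\<^sub>R u))\<^sup>2 = (norm x)\<^sup>2 + \<mu>\<^sup>2 * (norm u)\<^sup>2"
  using norm_add_sq[of x "(- \<mu>) *\<^sub>R u"] Re_cinner_graph[OF assms] Re_cinner_commute[of x u]
  by (simp add: cinner_scaleR_right power_mult_distrib cinner.minus_right)

lemma resolvent_bounds:
  assumes "(x, u) \<in> A"
  shows "norm x \<le> norm (x - \<mu> *\<^sub>R u)" "\<bar>\<mu>\<bar> * norm u \<le> norm (x - \<mu> *\<^sub>R u)"
proof -
  show "norm x \<le> norm (x - \<mu> *\<^sub>R u)"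
    by (rule power2_le_imp_le) (simp_all add: norm_resolvent_sq[OF assms])
  show "\<bar>\<mu>\<bar> * norm u \<le> norm (x - \<mu> *\<^sub>R u)"
    by (rule power2_le_imp_le) (simp_all add: norm_resolvent_sq[OF assms] power_mult_distrib)
qed

text \<open>
  The range of \<open>1 - \<mu> A\<close> is closed by the two bounds above. A vector \<open>z\<close> orthogonal to it lies in
  the domain of the adjoint, hence of \<open>A\<close>, and satisfies \<open>A z = - z / \<mu>\<close>; as \<open>A z\<close> is orthogonal
  to \<open>z\<close> for the real inner product, this forces \<open>z = 0\<close>.
\<close>

lemma resolvent_exists:
  assumes "\<mu> \<noteq> 0"
  obtains x u where "(x, u) \<in> A" "x - \<mu> *\<^sub>R u = y"
proof -
  define M where "M = {x - \<mu> *\<^sub>R u | x u. (x, u) \<in> A}"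
  have "closed M"
    unfolding closed_sequential_limits
  proof clarify
    fix f l assume f: "\<forall>n. f n \<in> M" and l: "f \<longlonglongrightarrow> l"
    then have "\<forall>n. \<exists>x u. (x, u) \<in> A \<and> f n = x - \<mu> *\<^sub>R u"
      unfolding M_def by blast
    then obtain x u where xu: "\<And>n. (x n, u n) \<in> A" "\<And>n. f n = x n - \<mu> *\<^sub>R u n"
      by metis
    have diff: "f n - f m = (x n - x m) - \<mu> *\<^sub>R (u n - u m)" for n m
      by (simp add: xu(2) algebra_simps)
    have bx: "norm (x n - x m) \<le> norm (f n - f m)" for n m
      unfolding diff by (rule resolvent_bounds(1)[OF graph_diff[OF xu(1) xu(1)]])
    have bu: "\<bar>\<mu>\<bar> * norm (u n - u m) \<le> norm (f n - f m)" for n m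
      unfolding diff by (rule resolvent_bounds(2)[OF graph_diff[OF xu(1) xu(1)]])
    have C: "Cauchy f" using l by (rule LIMSEQ_imp_Cauchy)
    have "Cauchy x"
      using C bx unfolding Cauchy_def dist_norm by (meson le_less_trans)
    moreover have "Cauchy u"
    proof (rule metric_CauchyI)
      fix e :: real assume "0 < e"
      then obtain N where N: "\<And>m n. m \<ge> N \<Longrightarrow> n \<ge> N \<Longrightarrow> norm (f m - f n) < \<bar>\<mu>\<bar> * e"
        using C assms unfolding Cauchy_def dist_norm by (metis mult_pos_pos zero_less_abs_iff)
      have "dist (u m) (u n) < e" if "m \<ge> N" "n \<ge> N" for m n
        using le_less_trans[OF bu N[OF that]] assms by (simp add: dist_norm)
      then show "\<exists>N. \<forall>m\<ge>N. \<forall>n\<ge>N. dist (u m) (u n) < e" by blast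
    qed
    ultimately obtain x' u' where lim: "x \<longlonglongrightarrow> x'" "u \<longlonglongrightarrow> u'"
      by (auto simp: Cauchy_convergent_iff convergent_def)
    have "f \<longlonglongrightarrow> x' - \<mu> *\<^sub>R u'"
      using tendsto_diff[OF lim(1) tendsto_scaleR[OF tendsto_const[of \<mu>] lim(2)]]
      by (simp add: xu(2)[symmetric])
    with l have "l = x' - \<mu> *\<^sub>R u'" by (rule LIMSEQ_unique)
    then show "l \<in> M" using graph_closed[OF xu(1) lim] M_def by blast
  qed
  have "M = UNIV"
  proof (rule ccontr)
    assume "M \<noteq> UNIV"
    obtain z where z: "z \<noteq> 0" "\<And>m. m \<in> M \<Longrightarrow> cinner m z = 0"
    proof (rule exists_orthogonal_vector[OF \<open>closed M\<close> \<open>M \<noteq> UNIV\<close>])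
      have "0 - \<mu> *\<^sub>R 0 \<in> M" unfolding M_def using graph_zero by blast
      then show "0 \<in> M" by simp
    next
      fix p q assume "p \<in> M" "q \<in> M"
      then obtain x u x' u' where *: "(x, u) \<in> A" "(x', u') \<in> A"
        "p = x - \<mu> *\<^sub>R u" "q = x' - \<mu> *\<^sub>R u'" unfolding M_def by blast
      have "(x + x') - \<mu> *\<^sub>R (u + u') \<in> M"
        unfolding M_def using graph_add[OF *(1,2)] by blast
      then show "p + q \<in> M" by (simp add: * algebra_simps)
    next
      fix c p assume "p \<in> M"
      then obtain x u where *: "(x, u) \<in> A" "p = x - \<mu> *\<^sub>R u" unfolding M_def by blast
      have "c *\<^sub>C x - \<mu> *\<^sub>R c *\<^sub>C u \<in> M"
        unfolding M_def using graph_scaleC[OF *(1)] by blast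
      then show "c *\<^sub>C p \<in> M" by (simp add: * scaleC_diff_right scaleC_scaleR_right)
    qed blast
    have "(z, (- 1 / \<mu>) *\<^sub>R z) \<in> A"
      unfolding adjoint
    proof clarify
      fix x u assume "(x, u) \<in> A"
      then have "cinner (x - \<mu> *\<^sub>R u) z = 0" using z(2) M_def by blast
      then show "cinner u z = - cinner x ((- 1 / \<mu>) *\<^sub>R z)"
        using assms
        by (simp add: cinner.diff_left cinner_scaleR_left cinner_scaleR_right cinner.minus_right)
    qed
    from Re_cinner_graph[OF this] show False
      using assms z(1) by (simp add: cinner_scaleR_left cinner.minus_left cinner_self)
  qed
  then have "y \<in> M" by simp
  then show ?thesis using that unfolding M_def by blast
qed

text \<open>
  The resolvent \<open>(1 - \<mu> A)\<inverse>\<close>. For \<open>\<mu> = 0\<close> the value is arbitrary outside the domain of \<open>A\<close>, which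
  is why \<open>\<mu> \<noteq> 0\<close> is assumed below.
\<close>

definition res :: "real \<Rightarrow> 'a \<Rightarrow> 'a" where
  "res \<mu> y = fst (SOME p. p \<in> A \<and> fst p - \<mu> *\<^sub>R snd p = y)"

lemma res_eqI:
  assumes "(x, u) \<in> A" "x - \<mu> *\<^sub>R u = y"
  shows "res \<mu> y = x"
proof -
  define p where "p = (SOME p. p \<in> A \<and> fst p - \<mu> *\<^sub>R snd p = y)"
  have p: "p \<in> A \<and> fst p - \<mu> *\<^sub>R snd p = y"
    unfolding p_def by (rule someI[of _ "(x, u)"]) (use assms in auto)
  then have "(fst p - x, snd p - u) \<in> A" using graph_diff[of "fst p" "snd p"] assms(1) by simp
  from resolvent_bounds(1)[OF this, of \<mu>] have "norm (fst p - x) \<le> norm ((fst p - \<mu> *\<^sub>R snd p) - (x - \<mu> *\<^sub>R u))"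
    by (simp add: algebra_simps)
  then show ?thesis using p assms(2) by (simp add: res_def p_def[symmetric])
qed

lemma res_graph:
  assumes "\<mu> \<noteq> 0"
  shows "(res \<mu> y, (1 / \<mu>) *\<^sub>R (res \<mu> y - y)) \<in> A"
proof -
  obtain x u where xu: "(x, u) \<in> A" "x - \<mu> *\<^sub>R u = y"
    using resolvent_exists[OF assms] .
  have "(1 / \<mu>) *\<^sub>R (x - y) = u" using assms by (simp add: xu(2)[symmetric])
  then show ?thesis using xu res_eqI[OF xu] by simp
qed

lemma res_graph_apply:
  assumes "(x, u) \<in> A" "\<mu> \<noteq> 0"
  shows "res \<mu> u = (1 / \<mu>) *\<^sub>R (res \<mu> x - x)"
proof (rule res_eqI)
  show "((1 / \<mu>) *\<^sub>R (res \<mu> x - x), (1 / \<mu>) *\<^sub>R ((1 / \<mu>) *\<^sub>R (res \<mu> x - x) - u)) \<in> A"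
    by (intro graph_scaleR graph_diff res_graph assms)
qed (use assms in \<open>simp add: algebra_simps\<close>)

lemma res_add: "\<mu> \<noteq> 0 \<Longrightarrow> res \<mu> (x + y) = res \<mu> x + res \<mu> y"
  by (rule res_eqI[OF graph_add[OF res_graph[of \<mu> x] res_graph[of \<mu> y]]])
     (simp_all add: algebra_simps)

lemma res_scaleC: "\<mu> \<noteq> 0 \<Longrightarrow> res \<mu> (c *\<^sub>C x) = c *\<^sub>C res \<mu> x"
  by (rule res_eqI[OF graph_scaleC[OF res_graph[of \<mu> x]]])
     (simp_all add: scaleC_diff_right flip: scaleC_scaleR_right)

lemma res_norm_le: "\<mu> \<noteq> 0 \<Longrightarrow> norm (res \<mu> x) \<le> norm x"
  using resolvent_bounds(1)[OF res_graph[of \<mu> x], of \<mu>] by simp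

lemma bounded_linear_res: "\<mu> \<noteq> 0 \<Longrightarrow> bounded_linear (res \<mu>)"
  by (rule bounded_linear_intro[where K=1])
     (simp_all add: res_add res_norm_le res_scaleC flip: scaleC_of_real)

lemma res_commute:
  assumes "\<mu> \<noteq> 0" "\<nu> \<noteq> 0"
  shows "res \<mu> (res \<nu> y) = res \<nu> (res \<mu> y)"
proof -
  define x where "x = res \<mu> (res \<nu> y)"
  define Ax where "Ax = (1 / \<mu>) *\<^sub>R (x - res \<nu> y)"
  have x: "(x, Ax) \<in> A"
    unfolding x_def Ax_def by (rule res_graph[OF assms(1)])
  have Ax: "(Ax, (1 / \<mu>) *\<^sub>R (Ax - (1 / \<nu>) *\<^sub>R (res \<nu> y - y))) \<in> A"
    by (subst Ax_def) (intro graph_scaleR graph_diff x res_graph assms)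
  \<comment> \<open>\<open>(1 - \<mu> A) (1 - \<nu> A) x = (1 - \<nu> A) (1 - \<mu> A) x = y\<close>, where \<open>A\<^sup>2 x\<close> makes sense by the last fact\<close>
  have "res \<mu> y = x - \<nu> *\<^sub>R Ax"
  proof (rule res_eqI)
    show "(x - \<nu> *\<^sub>R Ax, Ax - \<nu> *\<^sub>R (1 / \<mu>) *\<^sub>R (Ax - (1 / \<nu>) *\<^sub>R (res \<nu> y - y))) \<in> A"
      by (rule graph_diff[OF x graph_scaleR[OF Ax]])
    show "(x - \<nu> *\<^sub>R Ax) - \<mu> *\<^sub>R (Ax - \<nu> *\<^sub>R (1 / \<mu>) *\<^sub>R (Ax - (1 / \<nu>) *\<^sub>R (res \<nu> y - y))) = y"
      using assms by (simp add: Ax_def algebra_simps)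
  qed
  then have "res \<nu> (res \<mu> y) = x"
    using res_eqI[OF x, of \<nu>] by simp
  then show ?thesis by (simp add: x_def)
qed

lemma res_adjoint:
  assumes "\<mu> \<noteq> 0"
  shows "cinner (res \<mu> x) y = cinner x (res (- \<mu>) y)"
proof -
  have "cinner ((1 / \<mu>) *\<^sub>R (res \<mu> x - x)) (res (- \<mu>) y)
      = - cinner (res \<mu> x) ((1 / - \<mu>) *\<^sub>R (res (- \<mu>) y - y))"
    using assms by (intro skew res_graph) auto
  then show ?thesis
    using assms
    by (simp add: cinner_scaleR_left cinner_scaleR_right cinner.diff_left cinner.diff_right
        cinner.minus_right)
qed

lemma res_diff_le:
  assumes "(x, u) \<in> A" "\<mu> \<noteq> 0"
  shows "norm (res \<mu> x - x) \<le> \<bar>\<mu>\<bar> * norm u"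
proof -
  have "res \<mu> x - x = \<mu> *\<^sub>R res \<mu> u"
    using assms by (simp add: res_graph_apply)
  then show ?thesis using res_norm_le[OF assms(2), of u] by (simp add: mult_left_mono)
qed

text \<open>
  On the domain the convergence is linear in \<open>\<mu>\<close>; density and contractivity of the resolvents
  extend it to every vector, at the price of losing the rate.
\<close>

lemma res_tendsto: "((\<lambda>\<mu>. res \<mu> x) \<longlongrightarrow> x) (at 0)"
proof (rule tendstoI)
  fix e :: real assume "0 < e"
  then obtain y v where yv: "(y, v) \<in> A" "norm (x - y) < e / 3"
    using approx[of "e/3" x] by auto
  have "((\<lambda>\<mu>. \<bar>\<mu>\<bar> * norm v) \<longlongrightarrow> 0 * norm v) (at 0)"
    by (intro tendsto_intros tendsto_rabs_zero)
  then have "\<forall>\<^sub>F \<mu> in at 0. \<bar>\<mu>\<bar> * norm v < e / 3"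
    using \<open>0 < e\<close> by (intro order_tendstoD(2)) auto
  moreover have "\<forall>\<^sub>F \<mu>::real in at 0. \<mu> \<noteq> 0" by (auto simp: eventually_at_filter)
  ultimately show "\<forall>\<^sub>F \<mu> in at 0. dist (res \<mu> x) x < e"
  proof eventually_elim
    fix \<mu> :: real assume v: "\<bar>\<mu>\<bar> * norm v < e / 3" and \<mu>: "\<mu> \<noteq> 0"
    interpret R: bounded_linear "res \<mu>" by (rule bounded_linear_res[OF \<mu>])
    have "res \<mu> x - x = res \<mu> (x - y) + (res \<mu> y - y) - (x - y)"
      by (simp add: R.diff)
    also have "norm \<dots> \<le> norm (res \<mu> (x - y)) + norm (res \<mu> y - y) + norm (x - y)"
      by (rule norm_triangle_le_diff add_right_mono norm_triangle_ineq)+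
    also have "\<dots> < e"
      using res_norm_le[OF \<mu>, of "x - y"] res_diff_le[OF yv(1) \<mu>] v yv(2) by simp
    finally show "dist (res \<mu> x) x < e" by (simp add: dist_norm)
  qed
qed

text \<open>
  This is \<open>A (1 - \<mu>\<^sup>2 A\<^sup>2)\<inverse>\<close>, written in partial fractions. In contrast to the
  one-sided Yosida approximation \<open>A (1 - \<mu> A)\<inverse>\<close> it is again skew-symmetric, so that its
  exponentials are unitary.
\<close>

definition yosida :: "real \<Rightarrow> 'a \<Rightarrow> 'a" where
  "yosida \<mu> y = (1 / (2 * \<mu>)) *\<^sub>R (res \<mu> y - res (- \<mu>) y)"

lemma bounded_linear_yosida: "\<mu> \<noteq> 0 \<Longrightarrow> bounded_linear (yosida \<mu>)"
  unfolding yosida_def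
  by (intro bounded_linear_const_scaleR bounded_linear_sub bounded_linear_res) auto

lemma yosida_scaleC: "\<mu> \<noteq> 0 \<Longrightarrow> yosida \<mu> (c *\<^sub>C x) = c *\<^sub>C yosida \<mu> x"
  by (simp add: yosida_def res_scaleC scaleC_diff_right scaleC_scaleR_right)

lemma yosida_skew: "\<mu> \<noteq> 0 \<Longrightarrow> cinner (yosida \<mu> x) y = - cinner x (yosida \<mu> y)"
  by (simp add: yosida_def cinner_scaleR_left cinner_scaleR_right cinner.diff_left
      cinner.diff_right res_adjoint algebra_simps)

lemma yosida_commute:
  assumes "\<mu> \<noteq> 0" "\<nu> \<noteq> 0"
  shows "yosida \<mu> (yosida \<nu> x) = yosida \<nu> (yosida \<mu> x)"
proof -
  have *: "res \<alpha> (yosida \<beta> x) = (1 / (2 * \<beta>)) *\<^sub>R (res \<beta> (res \<alpha> x) - res (- \<beta>) (res \<alpha> x))"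
    if "\<alpha> \<noteq> 0" "\<beta> \<noteq> 0" for \<alpha> \<beta>
  proof -
    interpret R: bounded_linear "res \<alpha>" by (rule bounded_linear_res[OF that(1)])
    show ?thesis using that by (simp add: yosida_def R.scaleR R.diff res_commute[of \<alpha>])
  qed
  show ?thesis
    unfolding yosida_def[of \<mu> "yosida \<nu> x"] yosida_def[of \<nu> "yosida \<mu> x"]
    using assms by (simp add: * res_commute[of \<mu>] res_commute[of "-\<mu>"] algebra_simps)
qed

lemma yosida_graph:
  assumes "(x, u) \<in> A" "\<mu> \<noteq> 0"
  shows "yosida \<mu> x = (1 / 2) *\<^sub>R (res \<mu> u + res (- \<mu>) u)"
proof -
  have "res \<mu> u = (1 / \<mu>) *\<^sub>R (res \<mu> x - x)"
    "res (- \<mu>) u = (1 / - \<mu>) *\<^sub>R (res (- \<mu>) x - x)"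
    by (rule res_graph_apply; use assms in simp)+
  then show ?thesis by (simp only:) (simp add: yosida_def algebra_simps)
qed

lemma yosida_norm_le:
  assumes "(x, u) \<in> A" "\<mu> \<noteq> 0"
  shows "norm (yosida \<mu> x) \<le> norm u"
  unfolding yosida_graph[OF assms]
  using norm_triangle_ineq[of "res \<mu> u" "res (- \<mu>) u"]
    res_norm_le[of \<mu> u] res_norm_le[of "- \<mu>" u] assms(2) by simp

lemma yosida_tendsto:
  assumes "(x, u) \<in> A"
  shows "((\<lambda>\<mu>. yosida \<mu> x) \<longlongrightarrow> u) (at 0)"
proof -
  have "((\<lambda>\<mu>. res (- \<mu>) u) \<longlongrightarrow> u) (at 0)"
  proof (rule filterlim_compose[OF res_tendsto])
    show "filterlim uminus (at 0) (at (0::real))"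
      using tendsto_minus[OF tendsto_ident_at[of "0::real" UNIV]]
      by (auto simp: filterlim_at eventually_at_filter)
  qed
  with res_tendsto have "((\<lambda>\<mu>. (1 / 2) *\<^sub>R (res \<mu> u + res (- \<mu>) u)) \<longlongrightarrow> (1 / 2) *\<^sub>R (u + u)) (at 0)"
    by (intro tendsto_intros)
  moreover have "\<forall>\<^sub>F \<mu> in at 0. (1 / 2) *\<^sub>R (res \<mu> u + res (- \<mu>) u) = yosida \<mu> x"
    by (simp add: eventually_at_filter yosida_graph[OF assms])
  ultimately have "((\<lambda>\<mu>. yosida \<mu> x) \<longlongrightarrow> (1 / 2) *\<^sub>R (u + u)) (at 0)"
    by (rule Lim_transform_eventually)
  moreover have "(1 / 2) *\<^sub>R (u + u) = u" by (simp flip: scaleR_2)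
  ultimately show ?thesis by simp
qed

end

section \<open>Exponentials of bounded skew-symmetric operators\<close>

text \<open>
  The orbit \<open>exp (t B) x\<close>. Vectors rather than operators are summed since the bounded operators
  on a possibly trivial space are no unital normed algebra in the sense of the type classes, which
  requires \<open>\<parallel>1\<parallel> = 1\<close>.
\<close>

definition exp_flow :: "('b::banach \<Rightarrow> 'b) \<Rightarrow> real \<Rightarrow> 'b \<Rightarrow> 'b" where
  "exp_flow B t x = (\<Sum>n. (t ^ n / fact n) *\<^sub>R (B ^^ n) x)"

lemma norm_funpow_le:
  fixes B :: "'b::banach \<Rightarrow> 'b"
  assumes "bounded_linear B"
  shows "norm ((B ^^ n) x) \<le> onorm B ^ n * norm x"
proof (induction n)
  case (Suc n)
  have "norm (B ((B ^^ n) x)) \<le> onorm B * norm ((B ^^ n) x)"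
    by (rule onorm[OF assms])
  also have "\<dots> \<le> onorm B * (onorm B ^ n * norm x)"
    by (rule mult_left_mono[OF Suc onorm_pos_le[OF assms]])
  finally show ?case by (simp add: mult.assoc)
qed simp

lemma exp_term_le:
  fixes B :: "'b::banach \<Rightarrow> 'b"
  assumes "bounded_linear B" "\<bar>t\<bar> \<le> R"
  shows "norm ((t ^ n / fact n) *\<^sub>R (B ^^ n) x) \<le> (R * onorm B) ^ n / fact n * norm x"
proof -
  have "norm ((t ^ n / fact n) *\<^sub>R (B ^^ n) x) = \<bar>t\<bar> ^ n / fact n * norm ((B ^^ n) x)"
    by (simp add: power_abs)
  also have "\<dots> \<le> R ^ n / fact n * (onorm B ^ n * norm x)"
    using assms by (intro mult_mono divide_right_mono power_mono norm_funpow_le) auto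
  finally show ?thesis by (simp add: power_mult_distrib)
qed

lemma summable_exp_bound: "summable (\<lambda>n. (r::real) ^ n / fact n * c)"
  using summable_exp[of r] by (intro summable_mult2) (simp add: divide_inverse mult.commute)

lemma summable_exp_flow:
  fixes B :: "'b::banach \<Rightarrow> 'b"
  assumes "bounded_linear B"
  shows "summable (\<lambda>n. (t ^ n / fact n) *\<^sub>R (B ^^ n) x)"
  by (rule summable_comparison_test'[OF summable_exp_bound exp_term_le[OF assms order.refl]])

lemma exp_flow_add:
  assumes "bounded_linear B"
  shows "exp_flow B t (x + y) = exp_flow B t x + exp_flow B t y"
proof -
  have "(B ^^ n) (x + y) = (B ^^ n) x + (B ^^ n) y" for n
    by (induction n) (simp_all add: linear_add[OF bounded_linear.linear[OF assms]])
  then show ?thesis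
    unfolding exp_flow_def
    by (simp add: scaleR_add_right suminf_add[OF summable_exp_flow summable_exp_flow, OF assms assms])
qed

lemma exp_flow_commute:
  assumes "bounded_linear B" "bounded_linear C" "\<And>x. C (B x) = B (C x)"
  shows "C (exp_flow B t x) = exp_flow B t (C x)"
proof -
  have "C ((B ^^ n) x) = (B ^^ n) (C x)" for n
    by (induction n) (simp_all add: assms(3))
  then show ?thesis
    unfolding exp_flow_def
    by (simp add: bounded_linear.suminf[OF assms(2) summable_exp_flow[OF assms(1)]]
        linear_scale[OF bounded_linear.linear[OF assms(2)]])
qed

lemma exp_flow_0 [simp]: "exp_flow B 0 x = x"
proof -
  have "(\<lambda>n. (0 ^ n / fact n) *\<^sub>R (B ^^ n) x) = (\<lambda>n. if n = 0 then x else 0)"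
    by (auto simp: fun_eq_iff power_0_left)
  then show ?thesis
    unfolding exp_flow_def using sums_unique[OF sums_single[of 0 "\<lambda>_. x"]] by simp
qed

lemma exp_flow_has_vector_derivative:
  fixes B :: "'b::banach \<Rightarrow> 'b"
  assumes B: "bounded_linear B"
  shows "((\<lambda>t. exp_flow B t x) has_vector_derivative B (exp_flow B t x)) (at t)"
proof -
  \<comment> \<open>On a bounded neighbourhood of \<open>t\<close> the series of derivatives converges uniformly. The\<close>
  \<comment> \<open>derivative of the term with index \<open>Suc m\<close> is the term with index \<open>m\<close> of the orbit of \<open>B x\<close>.\<close>
  define S where "S = {- (\<bar>t\<bar> + 1) <..< \<bar>t\<bar> + 1}"
  define f where "f n s = (s ^ n / fact n) *\<^sub>R (B ^^ n) x" for n and s :: real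
  define f' where "f' n s = (case n of 0 \<Rightarrow> 0 | Suc m \<Rightarrow> (s ^ m / fact m) *\<^sub>R (B ^^ m) (B x))"
    for n and s :: real
  define M where "M n = (case n of 0 \<Rightarrow> 0
      | Suc m \<Rightarrow> ((\<bar>t\<bar> + 1) * onorm B) ^ m / fact m * norm (B x))" for n
  have "summable M"
    using summable_exp_bound[of "(\<bar>t\<bar> + 1) * onorm B" "norm (B x)"]
    by (subst summable_Suc_iff[symmetric]) (simp add: M_def)
  moreover have "norm (f' n s) \<le> M n" if "s \<in> S" for n s
    using that exp_term_le[OF B, of s "\<bar>t\<bar> + 1" _ "B x"]
    by (auto simp: f'_def M_def S_def split: nat.split)
  ultimately have ul: "uniform_limit S (\<lambda>n s. \<Sum>i<n. f' i s) (\<lambda>s. \<Sum>i. f' i s) sequentially"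
    by (intro Weierstrass_m_test)
  have sum: "(\<Sum>i. f' i s) = B (exp_flow B s x)" for s
  proof -
    have "(\<lambda>i. f' (Suc i) s) sums exp_flow B s (B x)"
      using summable_sums[OF summable_exp_flow[OF B]] by (simp add: f'_def exp_flow_def)
    then have "(\<lambda>i. f' i s) sums (exp_flow B s (B x) + f' 0 s)" by (rule sums_Suc)
    then show ?thesis
      by (simp add: sums_iff f'_def exp_flow_commute[OF B B])
  qed
  have "\<exists>g. \<forall>s\<in>S. (\<lambda>n. f n s) sums g s \<and>
      (g has_derivative (\<lambda>h. h *\<^sub>R (\<Sum>i. f' i s))) (at s within S)"
  proof (rule has_derivative_series)
    show "convex S" by (simp add: S_def)
    show "(f n has_derivative (\<lambda>h. h *\<^sub>R f' n s)) (at s within S)" for n s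
    proof (cases n)
      case 0
      then show ?thesis by (simp add: f_def[abs_def] f'_def)
    next
      case (Suc m)
      have "((\<lambda>s. s ^ Suc m / fact (Suc m)) has_real_derivative s ^ m / fact m) (at s within S)"
        by (rule derivative_eq_intros refl | simp)+ 
      then have "((\<lambda>s. (s ^ Suc m / fact (Suc m)) *\<^sub>R (B ^^ Suc m) x) has_vector_derivative
          (s ^ m / fact m) *\<^sub>R (B ^^ Suc m) x) (at s within S)"
        using has_vector_derivative_scaleR[OF _ has_vector_derivative_const] by fastforce
      then show ?thesis
        unfolding has_vector_derivative_def f_def[abs_def] Suc f'_def
        by (simp add: funpow_swap1)
    qed
    show "\<forall>\<^sub>F n in sequentially. \<forall>s\<in>S. \<forall>h.
        norm ((\<Sum>i<n. h *\<^sub>R f' i s) - h *\<^sub>R (\<Sum>i. f' i s)) \<le> e * norm h" if "0 < e" for e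
      using uniform_limitD[OF ul that]
    proof eventually_elim
      fix n assume *: "\<forall>s\<in>S. dist (\<Sum>i<n. f' i s) (\<Sum>i. f' i s) < e"
      show "\<forall>s\<in>S. \<forall>h. norm ((\<Sum>i<n. h *\<^sub>R f' i s) - h *\<^sub>R (\<Sum>i. f' i s)) \<le> e * norm h"
      proof (intro ballI allI)
        fix s h assume "s \<in> S"
        have "norm ((\<Sum>i<n. h *\<^sub>R f' i s) - h *\<^sub>R (\<Sum>i. f' i s))
            = \<bar>h\<bar> * dist (\<Sum>i<n. f' i s) (\<Sum>i. f' i s)"
          by (simp add: dist_norm flip: scaleR_sum_right scaleR_diff_right)
        also have "\<dots> \<le> \<bar>h\<bar> * e"
          using * \<open>s \<in> S\<close> by (intro mult_left_mono) auto
        finally show "norm ((\<Sum>i<n. h *\<^sub>R f' i s) - h *\<^sub>R (\<Sum>i. f' i s)) \<le> e * norm h"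
          by (simp add: mult.commute)
      qed
    qed
    show "t \<in> S" by (simp add: S_def abs_real_def)
    show "(\<lambda>n. f n t) sums exp_flow B t x"
      unfolding f_def exp_flow_def by (rule summable_sums[OF summable_exp_flow[OF B]])
  qed
  then obtain g where g: "\<And>s. s \<in> S \<Longrightarrow> (\<lambda>n. f n s) sums g s"
    "\<And>s. s \<in> S \<Longrightarrow> (g has_derivative (\<lambda>h. h *\<^sub>R (\<Sum>i. f' i s))) (at s within S)"
    by blast
  have tS: "t \<in> S" and oS: "open S" by (auto simp: S_def abs_real_def)
  have eq: "g s = exp_flow B s x" if "s \<in> S" for s
    using g(1)[OF that] by (simp add: sums_iff f_def exp_flow_def)
  have "(g has_vector_derivative B (exp_flow B t x)) (at t)"
    using g(2)[OF tS] unfolding has_vector_derivative_def sum by (simp add: at_within_open[OF tS oS])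
  then show ?thesis
    by (rule has_vector_derivative_transform_within_open[OF _ oS tS]) (simp add: eq)
qed

locale bounded_skew =
  fixes B :: "'a::chilbert_space \<Rightarrow> 'a"
  assumes bounded_linear: "bounded_linear B"
    and skew: "cinner (B x) y = - cinner x (B y)"
begin

lemma cinner_exp_flow: "cinner (exp_flow B t x) (exp_flow B t y) = cinner x y"
proof -
  have "((\<lambda>s. cinner (exp_flow B s x) (exp_flow B s y)) has_vector_derivative
      cinner (exp_flow B s x) (B (exp_flow B s y)) + cinner (B (exp_flow B s x)) (exp_flow B s y)) (at s)" for s
    by (intro cinner.has_vector_derivative exp_flow_has_vector_derivative bounded_linear)
  then have "((\<lambda>s. cinner (exp_flow B s x) (exp_flow B s y)) has_vector_derivative 0) (at s)" for s
    by (simp add: skew)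
  then show ?thesis
    using has_vector_derivative_zero_constant[of UNIV "\<lambda>s. cinner (exp_flow B s x) (exp_flow B s y)"]
    by (metis UNIV_I convex_UNIV exp_flow_0)
qed

lemma norm_exp_flow: "norm (exp_flow B t x) = norm x"
  using cinner_exp_flow[of t x x] by (simp add: cinner_self flip: of_real_power)

lemma exp_flow_diff: "exp_flow B t (x - y) = exp_flow B t x - exp_flow B t y"
  using exp_flow_add[OF bounded_linear, of t "x - y" y] by simp

text \<open>
  As functions of \<open>s\<close>, both sides solve \<open>u' = B u\<close> with the same value at \<open>s = 0\<close>, and the difference
  of two solutions has constant norm.
\<close>

lemma exp_flow_group: "exp_flow B (s + t) x = exp_flow B s (exp_flow B t x)"
proof -
  define w where "w s = exp_flow B (s + t) x - exp_flow B s (exp_flow B t x)" for s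
  have d: "(w has_vector_derivative B (w s)) (at s)" for s
  proof -
    have "((\<lambda>s. s + t) has_vector_derivative 1) (at s)"
      by (auto intro!: derivative_eq_intros)
    from vector_diff_chain_at[OF this exp_flow_has_vector_derivative[OF bounded_linear]]
    have "((\<lambda>s. exp_flow B (s + t) x) has_vector_derivative B (exp_flow B (s + t) x)) (at s)"
      by (simp add: o_def)
    then show ?thesis
      unfolding w_def[abs_def] linear_diff[OF bounded_linear.linear[OF bounded_linear]]
      by (intro has_vector_derivative_diff exp_flow_has_vector_derivative bounded_linear)
  qed
  have "Re (cinner (B (w s)) (w s)) = 0" for s
    using skew[of "w s" "w s"] Re_cinner_commute[of "w s" "B (w s)"] by simp
  with d have "norm (w s) = norm (w 0)" by (rule norm_constant_of_skew_derivative)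
  then show ?thesis by (simp add: w_def)
qed

end

text \<open>
  Duhamel's comparison of two commuting unitary flows: the derivative of
  \<open>s \<mapsto> \<langle>exp (s C) x, exp (s B) z\<rangle>\<close> is \<open>\<langle>exp (s C) (C x - B x), exp (s B) z\<rangle>\<close>, and \<open>z\<close> is chosen so
  that \<open>exp (t B) z\<close> is the difference that is to be estimated.
\<close>

lemma exp_flow_diff_le:
  assumes B: "bounded_skew B" and C: "bounded_skew C" and BC: "\<And>x. B (C x) = C (B x)"
  shows "norm (exp_flow C t x - exp_flow B t x) \<le> \<bar>t\<bar> * norm (C x - B x)"
proof -
  interpret B: bounded_skew B by (rule B)
  interpret C: bounded_skew C by (rule C)
  define d where "d = exp_flow C t x - exp_flow B t x"
  define z where "z = exp_flow B (- t) d"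
  have z: "exp_flow B t z = d" "norm z = norm d"
    using B.exp_flow_group[of t "- t" d] by (simp_all add: z_def B.norm_exp_flow)
  define f where "f s = cinner (exp_flow C s x) (exp_flow B s z)" for s
  have "norm (f t - f 0) \<le> norm (C x - B x) * norm z * \<bar>t\<bar>"
  proof (rule vector_derivative_bound)
    fix s
    have "cinner (exp_flow C s x) (B (exp_flow B s z)) + cinner (C (exp_flow C s x)) (exp_flow B s z)
       = cinner (C (exp_flow C s x) - B (exp_flow C s x)) (exp_flow B s z)"
      by (simp add: cinner.diff_left B.skew)
    also have "\<dots> = cinner (exp_flow C s (C x - B x)) (exp_flow B s z)"
      by (simp add: C.exp_flow_diff exp_flow_commute[OF C.bounded_linear C.bounded_linear]
          exp_flow_commute[OF C.bounded_linear B.bounded_linear BC])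
    finally have eq: "cinner (exp_flow C s x) (B (exp_flow B s z)) + cinner (C (exp_flow C s x)) (exp_flow B s z)
       = cinner (exp_flow C s (C x - B x)) (exp_flow B s z)" .
    show "(f has_vector_derivative cinner (exp_flow C s (C x - B x)) (exp_flow B s z)) (at s)"
      unfolding f_def[abs_def] eq[symmetric]
      by (intro cinner.has_vector_derivative exp_flow_has_vector_derivative
          B.bounded_linear C.bounded_linear)
    show "norm (cinner (exp_flow C s (C x - B x)) (exp_flow B s z)) \<le> norm (C x - B x) * norm z"
      using cinner_Cauchy_Schwarz[of "exp_flow C s (C x - B x)" "exp_flow B s z"]
      by (simp add: B.norm_exp_flow C.norm_exp_flow)
  qed
  moreover have "f 0 = cinner (exp_flow B t x) d"
    unfolding z(1)[symmetric] B.cinner_exp_flow by (simp add: f_def)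
  then have "f t - f 0 = cinner d d"
    by (simp add: f_def z(1) cinner.diff_left d_def)
  ultimately have "(norm d)\<^sup>2 \<le> norm (C x - B x) * norm d * \<bar>t\<bar>"
    by (simp add: cinner_self z(2) norm_power)
  then have "norm d * norm d \<le> norm d * (\<bar>t\<bar> * norm (C x - B x))"
    by (simp add: power2_eq_square algebra_simps)
  then show ?thesis
    unfolding d_def[symmetric] by (cases "d = 0") (auto simp: mult_le_cancel_left)
qed

section \<open>Stone's theorem\<close>

lemma unitary_group_cinner:
  assumes "unitary_group V"
  shows "cinner (V t x) (V t y) = cinner x y"
  using assms unfolding unitary_group_def unitary_op_def by blast

lemma unitary_group_norm:
  assumes "unitary_group V"
  shows "norm (V t x) = norm x"
  using unitary_group_cinner[OF assms, of t x x] by (simp add: cinner_self flip: of_real_power)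

lemma unitary_group_add:
  assumes "unitary_group V"
  shows "V (s + t) x = V s (V t x)"
  using assms unfolding unitary_group_def by simp

lemma unitary_group_minus:
  assumes "unitary_group V"
  shows "V t (V (- t) x) = x"
  using assms unitary_group_add[OF assms, of t "- t" x] unfolding unitary_group_def by simp

lemma unitary_group_adjoint:
  assumes "unitary_group V"
  shows "cinner (V t x) y = cinner x (V (- t) y)"
  using unitary_group_cinner[OF assms, of t x "V (- t) y"] unitary_group_minus[OF assms] by simp

lemma generator_quotient_tendsto:
  "(x, u) \<in> generator V \<Longrightarrow> ((\<lambda>t. (1 / t) *\<^sub>R (V t x - x)) \<longlongrightarrow> u) (at 0)"
  by (simp add: generator_def)

text \<open>\<open>V t\<close> commutes with the difference quotients of the group, hence with its generator.\<close>

lemma generator_invariant: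
  assumes V: "unitary_group V" and "(x, u) \<in> generator V"
  shows "(V t x, V t u) \<in> generator V"
proof -
  have "(1 / s) *\<^sub>R (V s (V t x) - V t x) = V t ((1 / s) *\<^sub>R (V s x - x))" for s
    by (simp add: blinfun.scaleR_right blinfun.diff_right add.commute
        flip: unitary_group_add[OF V])
  moreover have "((\<lambda>s. V t ((1 / s) *\<^sub>R (V s x - x))) \<longlongrightarrow> V t u) (at 0)"
    by (intro blinfun.tendsto tendsto_const generator_quotient_tendsto assms)
  ultimately show ?thesis by (simp add: generator_def)
qed

lemma orbit_has_vector_derivative:
  assumes V: "unitary_group V" and "(x, u) \<in> generator V"
  shows "((\<lambda>t. V t x) has_vector_derivative V t u) (at t)"
  unfolding has_vector_derivative_def has_derivative_at
proof
  show "bounded_linear (\<lambda>h. h *\<^sub>R V t u)" by (rule bounded_linear_scaleR_left)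
  have "((\<lambda>h. norm ((1 / h) *\<^sub>R (V h x - x) - u)) \<longlongrightarrow> 0) (at 0)"
    by (rule tendsto_norm_zero, subst LIM_zero_iff, rule generator_quotient_tendsto[OF assms(2)])
  moreover have "\<forall>\<^sub>F h in at 0. norm ((1 / h) *\<^sub>R (V h x - x) - u)
      = norm (V (t + h) x - V t x - h *\<^sub>R V t u) / norm h"
    unfolding eventually_at_filter
  proof (intro always_eventually allI impI)
    fix h :: real assume "h \<noteq> 0"
    then have "(1 / h) *\<^sub>R (V h x - x) - u = (1 / h) *\<^sub>R (V h x - x - h *\<^sub>R u)"
      by (simp add: scaleR_diff_right)
    then have "norm ((1 / h) *\<^sub>R (V h x - x) - u) = norm (V h x - x - h *\<^sub>R u) / norm h"
      by simp
    also have "norm (V h x - x - h *\<^sub>R u) = norm (V t (V h x - x - h *\<^sub>R u))"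
      by (simp only: unitary_group_norm[OF V])
    also have "V t (V h x - x - h *\<^sub>R u) = V (t + h) x - V t x - h *\<^sub>R V t u"
      by (simp add: blinfun.scaleR_right blinfun.diff_right unitary_group_add[OF V])
    finally show "norm ((1 / h) *\<^sub>R (V h x - x) - u)
      = norm (V (t + h) x - V t x - h *\<^sub>R V t u) / norm h" .
  qed
  ultimately show "(\<lambda>h. norm (V (t + h) x - V t x - h *\<^sub>R V t u) / norm h) \<midarrow>0\<rightarrow> 0"
    by (rule Lim_transform_eventually)
qed

text \<open>Differentiate \<open>\<langle>V t y, x\<rangle> = \<langle>y, V (- t) x\<rangle>\<close> at \<open>t = 0\<close>.\<close>

lemma generator_skew:
  assumes V: "unitary_group V" and "(x, u) \<in> generator V" "(y, v) \<in> generator V"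
  shows "cinner v x = - cinner y u"
proof -
  have "((\<lambda>t. cinner ((1 / t) *\<^sub>R (V t y - y)) x) \<longlongrightarrow> cinner v x) (at 0)"
    by (intro cinner.tendsto tendsto_const generator_quotient_tendsto assms)
  moreover have "filterlim uminus (at 0) (at (0::real))"
    using tendsto_minus[OF tendsto_ident_at[of "0::real" UNIV]]
    by (auto simp: filterlim_at eventually_at_filter)
  then have "((\<lambda>t. (1 / - t) *\<^sub>R (V (- t) x - x)) \<longlongrightarrow> u) (at 0)"
    by (rule filterlim_compose[OF generator_quotient_tendsto[OF assms(2)]])
  then have "((\<lambda>t. - cinner y ((1 / - t) *\<^sub>R (V (- t) x - x))) \<longlongrightarrow> - cinner y u) (at 0)"
    by (intro tendsto_minus cinner.tendsto tendsto_const)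
  moreover have "- cinner y ((1 / - t) *\<^sub>R (V (- t) x - x)) = cinner ((1 / t) *\<^sub>R (V t y - y)) x" for t
    by (simp add: cinner_scaleR_left cinner_scaleR_right cinner.diff_left cinner.diff_right
        cinner.minus_right unitary_group_adjoint[OF V])
  ultimately show ?thesis
    by (simp add: tendsto_unique[OF at_neq_bot])
qed

context skew_adjoint
begin

text \<open>
  For \<open>y\<close> in the domain of \<open>A\<close> the difference of the two orbits of \<open>y\<close> stays in the domain and
  has velocity \<open>A\<close> applied to it, so its norm is constant. Density of the domain does the rest.
\<close>

lemma unitary_group_unique:
  assumes V: "unitary_group V" "generator V = A" and W: "unitary_group W" "generator W = A"
  shows "V = W"
proof (intro ext blinfun_eqI)
  fix t x
  have eq: "V t y = W t y" if "(y, v) \<in> A" for y v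
  proof -
    have "norm (V t y - W t y) = norm (V 0 y - W 0 y)"
    proof (rule norm_constant_of_skew_derivative[where w="\<lambda>s. V s y - W s y"])
      show "((\<lambda>s. V s y - W s y) has_vector_derivative (V s v - W s v)) (at s)" for s
        using that assms by (intro has_vector_derivative_diff orbit_has_vector_derivative) auto
      show "Re (cinner (V s v - W s v) (V s y - W s y)) = 0" for s
        using that assms generator_invariant[of V y v s] generator_invariant[of W y v s]
        by (intro Re_cinner_graph graph_diff) auto
    qed
    then show ?thesis using V(1) W(1) by (simp add: unitary_group_def)
  qed
  have "norm (V t x - W t x) \<le> e" if \<open>0 < e\<close> for e
  proof -
    obtain y v where yv: "(y, v) \<in> A" "norm (x - y) < e / 2"
      using approx[of "e / 2" x] half_gt_zero[OF \<open>0 < e\<close>] by blast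
    have "V t x - W t x = V t (x - y) - W t (x - y)"
      by (simp add: blinfun.diff_right eq[OF yv(1)])
    also have "norm \<dots> \<le> norm (x - y) + norm (x - y)"
      using norm_triangle_ineq4[of "V t (x - y)" "W t (x - y)"]
      by (simp add: unitary_group_norm[OF V(1)] unitary_group_norm[OF W(1)])
    finally show ?thesis using yv(2) by simp
  qed
  then show "V t x = W t x"
    using field_le_epsilon[of "norm (V t x - W t x)" 0] by simp
qed

definition approx_gen :: "nat \<Rightarrow> 'a \<Rightarrow> 'a" where
  "approx_gen n = yosida (1 / real (Suc n))"

abbreviation approx_flow :: "nat \<Rightarrow> real \<Rightarrow> 'a \<Rightarrow> 'a" where
  "approx_flow n \<equiv> exp_flow (approx_gen n)"

lemma bounded_skew_approx_gen: "bounded_skew (approx_gen n)"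
  unfolding approx_gen_def by (intro bounded_skew.intro bounded_linear_yosida yosida_skew) auto

lemmas approx_flow_bounded_linear = bounded_skew.bounded_linear[OF bounded_skew_approx_gen]
  and cinner_approx_flow = bounded_skew.cinner_exp_flow[OF bounded_skew_approx_gen]
  and norm_approx_flow = bounded_skew.norm_exp_flow[OF bounded_skew_approx_gen]
  and approx_flow_group = bounded_skew.exp_flow_group[OF bounded_skew_approx_gen]
  and approx_flow_diff = bounded_skew.exp_flow_diff[OF bounded_skew_approx_gen]

lemma approx_gen_tendsto:
  assumes "(x, u) \<in> A"
  shows "(\<lambda>n. approx_gen n x) \<longlonglongrightarrow> u"
  unfolding approx_gen_def
proof (rule filterlim_compose[OF yosida_tendsto[OF assms]])
  show "filterlim (\<lambda>n. 1 / real (Suc n)) (at 0) sequentially"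
    using LIMSEQ_Suc[OF lim_1_over_n[where 'a=real]] by (simp add: filterlim_at)
qed

lemma approx_gen_norm_le: "(x, u) \<in> A \<Longrightarrow> norm (approx_gen n x) \<le> norm u"
  by (simp add: approx_gen_def yosida_norm_le)

text \<open>
  On the domain of \<open>A\<close> the flows form a Cauchy sequence because the generators do and commute
  with each other; as they are isometric, this extends to the closure of the domain.
\<close>

lemma Cauchy_approx_flow: "Cauchy (\<lambda>n. approx_flow n t x)"
proof (rule metric_CauchyI)
  fix e :: real assume "0 < e"
  then obtain y v where yv: "(y, v) \<in> A" "norm (x - y) < e / 3"
    using approx[of "e / 3" x] by auto
  have "Cauchy (\<lambda>n. \<bar>t\<bar> *\<^sub>R approx_gen n y)"
    by (intro LIMSEQ_imp_Cauchy[of _ "\<bar>t\<bar> *\<^sub>R v"] tendsto_intros approx_gen_tendsto yv)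
  then obtain N where N: "\<And>m n. m \<ge> N \<Longrightarrow> n \<ge> N \<Longrightarrow>
      \<bar>t\<bar> * norm (approx_gen m y - approx_gen n y) < e / 3"
    using \<open>0 < e\<close> metric_CauchyD[of "\<lambda>n. \<bar>t\<bar> *\<^sub>R approx_gen n y" "e / 3"]
    by (auto simp: dist_norm simp flip: scaleR_diff_right)
  have "dist (approx_flow m t x) (approx_flow n t x) < e" if "m \<ge> N" "n \<ge> N" for m n
  proof -
    have "approx_flow m t x - approx_flow n t x = approx_flow m t (x - y)
        + (approx_flow m t y - approx_flow n t y) - approx_flow n t (x - y)"
      by (simp add: approx_flow_diff)
    also have "norm \<dots> \<le> norm (approx_flow m t (x - y))
        + norm (approx_flow m t y - approx_flow n t y) + norm (approx_flow n t (x - y))"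
      by (rule norm_triangle_le_diff add_right_mono norm_triangle_ineq)+
    also have "norm (approx_flow m t y - approx_flow n t y) \<le> \<bar>t\<bar> * norm (approx_gen m y - approx_gen n y)"
      by (rule exp_flow_diff_le[OF bounded_skew_approx_gen bounded_skew_approx_gen])
         (simp add: approx_gen_def yosida_commute)
    also have "norm (approx_flow m t (x - y)) + \<bar>t\<bar> * norm (approx_gen m y - approx_gen n y)
        + norm (approx_flow n t (x - y)) < e"
      using N[OF that] yv(2) by (simp add: norm_approx_flow)
    finally show ?thesis by (simp add: dist_norm)
  qed
  then show "\<exists>N. \<forall>m\<ge>N. \<forall>n\<ge>N. dist (approx_flow m t x) (approx_flow n t x) < e" by blast
qed

definition flow :: "real \<Rightarrow> 'a \<Rightarrow> 'a" where
  "flow t x = lim (\<lambda>n. approx_flow n t x)"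

lemma approx_flow_tendsto: "(\<lambda>n. approx_flow n t x) \<longlonglongrightarrow> flow t x"
  using Cauchy_approx_flow by (simp add: flow_def Cauchy_convergent_iff convergent_LIMSEQ_iff)

lemma cinner_flow: "cinner (flow t x) (flow t y) = cinner x y"
  using cinner.tendsto[OF approx_flow_tendsto[of t x] approx_flow_tendsto[of t y]]
  by (simp add: cinner_approx_flow tendsto_const_iff)

lemma norm_flow: "norm (flow t x) = norm x"
  using cinner_flow[of t x x] by (simp add: cinner_self flip: of_real_power)

lemma flow_add: "flow t (x + y) = flow t x + flow t y"
  using tendsto_add[OF approx_flow_tendsto[of t x] approx_flow_tendsto[of t y]]
  by (intro LIMSEQ_unique[OF approx_flow_tendsto])
     (simp add: exp_flow_add[OF approx_flow_bounded_linear])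

lemma flow_scaleC: "flow t (c *\<^sub>C x) = c *\<^sub>C flow t x"
proof (rule LIMSEQ_unique[OF approx_flow_tendsto])
  have "approx_flow n t (c *\<^sub>C x) = c *\<^sub>C approx_flow n t x" for n
    by (rule exp_flow_commute[OF approx_flow_bounded_linear bounded_linear_scaleC, symmetric])
       (simp add: approx_gen_def yosida_scaleC)
  then show "(\<lambda>n. approx_flow n t (c *\<^sub>C x)) \<longlonglongrightarrow> c *\<^sub>C flow t x"
    by (simp add: tendsto_scaleC[OF approx_flow_tendsto])
qed

lemma bounded_linear_flow: "bounded_linear (flow t)"
  by (rule bounded_linear_intro[where K=1])
     (simp_all add: flow_add norm_flow flow_scaleC flip: scaleC_of_real)

lemma flow_zero: "flow 0 x = x"
  using approx_flow_tendsto[of 0 x] by (simp add: LIMSEQ_const_iff)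

text \<open>
  In the composition both the operator and its argument depend on \<open>n\<close>; since the operators are
  isometric, the argument may be replaced by its limit first.
\<close>

lemma flow_group: "flow (s + t) x = flow s (flow t x)"
proof (rule LIMSEQ_unique[OF approx_flow_tendsto])
  have "(\<lambda>n. approx_flow n t x - flow t x) \<longlonglongrightarrow> 0"
    using approx_flow_tendsto by (simp add: LIM_zero_iff)
  then have "(\<lambda>n. approx_flow n s (approx_flow n t x - flow t x)) \<longlonglongrightarrow> 0"
    by (subst tendsto_norm_zero_iff[symmetric]) (simp add: norm_approx_flow tendsto_norm_zero)
  from tendsto_add[OF this approx_flow_tendsto[of s "flow t x"]]
  show "(\<lambda>n. approx_flow n (s + t) x) \<longlonglongrightarrow> flow s (flow t x)"
    by (simp add: approx_flow_diff approx_flow_group)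
qed

text \<open>
  A bound that does not depend on \<open>n\<close>. It survives the limit and gives strong continuity, and it
  controls the velocity of the approximating orbits below.
\<close>

lemma approx_flow_displacement:
  assumes "(y, v) \<in> A"
  shows "norm (approx_flow n t x - x) \<le> 2 * norm (x - y) + \<bar>t\<bar> * norm v"
proof -
  have "norm (approx_flow n t y - approx_flow n 0 y) \<le> norm v * \<bar>t\<bar>"
  proof (rule vector_derivative_bound)
    show "((\<lambda>t. approx_flow n t y) has_vector_derivative approx_gen n (approx_flow n s y)) (at s)" for s
      by (rule exp_flow_has_vector_derivative[OF approx_flow_bounded_linear])
    show "norm (approx_gen n (approx_flow n s y)) \<le> norm v" for s
      using approx_gen_norm_le[OF assms]
      by (simp add: exp_flow_commute[OF approx_flow_bounded_linear approx_flow_bounded_linear]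
          norm_approx_flow)
  qed
  moreover have "norm (approx_flow n t x - x)
      \<le> norm (approx_flow n t (x - y)) + norm (approx_flow n t y - y) + norm (x - y)"
  proof -
    have "approx_flow n t x - x = approx_flow n t (x - y) + (approx_flow n t y - y) - (x - y)"
      by (simp add: approx_flow_diff)
    then show ?thesis
      using norm_triangle_ineq4[of "approx_flow n t (x - y) + (approx_flow n t y - y)" "x - y"]
        norm_triangle_ineq[of "approx_flow n t (x - y)" "approx_flow n t y - y"] by simp
  qed
  ultimately show ?thesis by (simp add: norm_approx_flow mult.commute)
qed

lemma flow_displacement:
  assumes "(y, v) \<in> A"
  shows "norm (flow t x - x) \<le> 2 * norm (x - y) + \<bar>t\<bar> * norm v"
  by (rule LIMSEQ_le_const2[OF tendsto_norm[OF tendsto_diff[OF approx_flow_tendsto tendsto_const]]])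
     (use approx_flow_displacement[OF assms] in blast)

lemma flow_tendsto_zero: "((\<lambda>t. flow t x) \<longlongrightarrow> x) (at 0)"
proof (rule tendstoI)
  fix e :: real assume "0 < e"
  then obtain y v where yv: "(y, v) \<in> A" "norm (x - y) < e / 4"
    using approx[of "e / 4" x] by auto
  have "((\<lambda>t. \<bar>t\<bar> * norm v) \<longlongrightarrow> 0 * norm v) (at 0)"
    by (intro tendsto_intros tendsto_rabs_zero)
  then have "\<forall>\<^sub>F t in at 0. \<bar>t\<bar> * norm v < e / 2"
    using \<open>0 < e\<close> by (intro order_tendstoD(2)) auto
  then show "\<forall>\<^sub>F t in at 0. dist (flow t x) x < e"
  proof eventually_elim
    case (elim t)
    then show ?case using flow_displacement[OF yv(1), of t x] yv(2) by (simp add: dist_norm)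
  qed
qed

lemma continuous_on_flow: "continuous_on UNIV (\<lambda>t. flow t x)"
  unfolding continuous_on_eq_continuous_at[OF open_UNIV] isCont_def
proof
  fix t
  have "((\<lambda>h. flow t (flow h x)) \<longlongrightarrow> flow t x) (at 0)"
    by (rule bounded_linear.tendsto[OF bounded_linear_flow flow_tendsto_zero])
  then show "((\<lambda>s. flow s x) \<longlongrightarrow> flow t x) (at t)"
    by (subst LIM_offset_zero_iff) (simp_all add: flow_group)
qed

text \<open>
  The velocity of the approximating flow at time \<open>s\<close> is \<open>exp (s A\<^sub>n) A\<^sub>n x\<close>; it differs from
  \<open>u = A x\<close> by at most \<open>\<parallel>A\<^sub>n x - u\<parallel>\<close> plus the displacement of \<open>u\<close>. The first term disappears in the
  limit \<open>n \<rightarrow> \<infinity>\<close>, and the second one is small for small \<open>t\<close>, uniformly in \<open>n\<close>.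
\<close>

lemma flow_expansion:
  assumes xu: "(x, u) \<in> A" and yv: "(y, v) \<in> A"
  shows "norm (flow t x - x - t *\<^sub>R u) \<le> (2 * norm (u - y) + \<bar>t\<bar> * norm v) * \<bar>t\<bar>"
proof -
  define f where "f n s = approx_flow n s x - s *\<^sub>R u" for n s
  have bound: "norm (f n t - f n 0)
      \<le> (norm (approx_gen n x - u) + (2 * norm (u - y) + \<bar>t\<bar> * norm v)) * \<bar>t\<bar>" for n
  proof (rule vector_derivative_bound)
    fix s
    have "((\<lambda>s. s *\<^sub>R u) has_vector_derivative u) (at s)"
      by (auto intro!: derivative_eq_intros)
    then show "(f n has_vector_derivative (approx_gen n (approx_flow n s x) - u)) (at s)"
      unfolding f_def[abs_def]
      by (intro has_vector_derivative_diff exp_flow_has_vector_derivative approx_flow_bounded_linear)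
    assume "\<bar>s\<bar> \<le> \<bar>t\<bar>"
    have "approx_gen n (approx_flow n s x) - u
        = approx_flow n s (approx_gen n x - u) + (approx_flow n s u - u)"
      by (simp add: exp_flow_commute[OF approx_flow_bounded_linear approx_flow_bounded_linear]
          approx_flow_diff)
    also have "norm \<dots> \<le> norm (approx_gen n x - u) + norm (approx_flow n s u - u)"
      using norm_triangle_ineq[of "approx_flow n s (approx_gen n x - u)" "approx_flow n s u - u"]
      by (simp add: norm_approx_flow)
    also have "norm (approx_flow n s u - u) \<le> 2 * norm (u - y) + \<bar>s\<bar> * norm v"
      by (rule approx_flow_displacement[OF yv])
    also have "\<bar>s\<bar> * norm v \<le> \<bar>t\<bar> * norm v"
      using \<open>\<bar>s\<bar> \<le> \<bar>t\<bar>\<close> by (rule mult_right_mono) simp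
    finally show "norm (approx_gen n (approx_flow n s x) - u)
        \<le> norm (approx_gen n x - u) + (2 * norm (u - y) + \<bar>t\<bar> * norm v)" by simp
  qed
  have "norm (flow t x - x - t *\<^sub>R u) \<le> (0 + (2 * norm (u - y) + \<bar>t\<bar> * norm v)) * \<bar>t\<bar>"
  proof (rule LIMSEQ_le)
    show "(\<lambda>n. norm (f n t - f n 0)) \<longlonglongrightarrow> norm (flow t x - x - t *\<^sub>R u)"
    proof -
      have "f n t - f n 0 = approx_flow n t x - x - t *\<^sub>R u" for n
        by (simp add: f_def)
      then show ?thesis by (simp only:) (intro tendsto_intros approx_flow_tendsto)
    qed
    have "(\<lambda>n. norm (approx_gen n x - u)) \<longlonglongrightarrow> 0"
      using approx_gen_tendsto[OF xu] by (simp add: LIM_zero_iff tendsto_norm_zero)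
    then show "(\<lambda>n. (norm (approx_gen n x - u) + (2 * norm (u - y) + \<bar>t\<bar> * norm v)) * \<bar>t\<bar>)
        \<longlonglongrightarrow> (0 + (2 * norm (u - y) + \<bar>t\<bar> * norm v)) * \<bar>t\<bar>"
      by (intro tendsto_intros)
  qed (use bound in blast)
  then show ?thesis by simp
qed

lemma flow_quotient_tendsto:
  assumes xu: "(x, u) \<in> A"
  shows "((\<lambda>t. (1 / t) *\<^sub>R (flow t x - x)) \<longlongrightarrow> u) (at 0)"
proof (rule tendstoI)
  fix e :: real assume "0 < e"
  then obtain y v where yv: "(y, v) \<in> A" "norm (u - y) < e / 4"
    using approx[of "e / 4" u] by auto
  have "((\<lambda>t. \<bar>t\<bar> * norm v) \<longlongrightarrow> 0 * norm v) (at 0)"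
    by (intro tendsto_intros tendsto_rabs_zero)
  then have "\<forall>\<^sub>F t in at 0. \<bar>t\<bar> * norm v < e / 2"
    using \<open>0 < e\<close> by (intro order_tendstoD(2)) auto
  moreover have "\<forall>\<^sub>F t::real in at 0. t \<noteq> 0" by (auto simp: eventually_at_filter)
  ultimately show "\<forall>\<^sub>F t in at 0. dist ((1 / t) *\<^sub>R (flow t x - x)) u < e"
  proof eventually_elim
    case (elim t)
    then have "(1 / t) *\<^sub>R (flow t x - x) - u = (1 / t) *\<^sub>R (flow t x - x - t *\<^sub>R u)"
      by (simp add: scaleR_diff_right)
    then have "dist ((1 / t) *\<^sub>R (flow t x - x)) u = norm (flow t x - x - t *\<^sub>R u) / \<bar>t\<bar>"
      by (simp add: dist_norm)
    also have "\<dots> \<le> 2 * norm (u - y) + \<bar>t\<bar> * norm v"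
      using flow_expansion[OF xu yv(1), of t] elim by (simp add: divide_le_eq)
    also have "\<dots> < e" using elim yv(2) by simp
    finally show ?case .
  qed
qed

text \<open>
  The generator of the limit group extends \<open>A\<close>. It is skew-symmetric, so each of its
  elements satisfies the relation against \<open>A\<close> that characterizes the elements of \<open>- A\<^sup>* = A\<close>: the
  extension is not proper.
\<close>

theorem unitary_group_exists:
  obtains V where "unitary_group V" "generator V = A"
proof -
  define V where "V t = Blinfun (flow t)" for t
  have V: "blinfun_apply (V t) = flow t" for t
    by (simp add: V_def bounded_linear_Blinfun_apply bounded_linear_flow)
  have "surj (flow t)" for t
    by (rule surjI[of _ "flow (- t)"]) (simp add: flow_zero flip: flow_group)
  then have group: "unitary_group V"
    unfolding unitary_group_def unitary_op_def bounded_ops_def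
    by (auto simp: V flow_scaleC cinner_flow flow_zero flow_group continuous_on_flow
        intro!: blinfun_eqI)
  have sub: "A \<subseteq> generator V"
    by (auto simp: generator_def V flow_quotient_tendsto)
  moreover have "generator V \<subseteq> A"
  proof
    fix p assume "p \<in> generator V"
    then obtain x u where p: "p = (x, u)" "(x, u) \<in> generator V" by (cases p) auto
    have "(x, u) \<in> A"
      unfolding adjoint using generator_skew[OF group p(2)] sub by blast
    then show "p \<in> A" by (simp add: p)
  qed
  ultimately show ?thesis using that group by blast
qed

end

text \<open>
  For the adjoint relation, \<open>\<langle>i \<phi>, y\<rangle> = - \<langle>x, v\<rangle>\<close> is the same equation as
  \<open>\<langle>\<phi>, y\<rangle> = \<langle>x, - i v\<rangle>\<close>.
\<close>

lemma self_adjoint_imp_skew_adjoint: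
  assumes "self_adjoint D"
  shows "skew_adjoint {(\<xi>, \<i> *\<^sub>C \<phi>) | \<xi> \<phi>. (\<xi>, \<phi>) \<in> D}" (is "skew_adjoint ?A")
proof
  have "Domain ?A = Domain D" by auto
  then show "closure (Domain ?A) = UNIV"
    using assms by (simp add: self_adjoint_def densely_defined_op_def)
next
  fix y v
  have "(y, v) \<in> ?A \<longleftrightarrow> (y, - \<i> *\<^sub>C v) \<in> D"
  proof
    assume "(y, - \<i> *\<^sub>C v) \<in> D"
    moreover have "v = \<i> *\<^sub>C (- \<i>) *\<^sub>C v" by (simp only: scaleC_scaleC) simp
    ultimately show "(y, v) \<in> ?A" by blast
  qed (auto simp: scaleC_scaleC)
  also have "\<dots> \<longleftrightarrow> (y, - \<i> *\<^sub>C v) \<in> op_adjoint D"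
    using assms by (simp add: self_adjoint_def)
  also have "\<dots> \<longleftrightarrow> (\<forall>(x, \<phi>)\<in>D. cinner (\<i> *\<^sub>C \<phi>) y = - cinner x v)"
  proof -
    have "cinner \<phi> y = cinner x (- \<i> *\<^sub>C v) \<longleftrightarrow> cinner (\<i> *\<^sub>C \<phi>) y = - cinner x v" for x \<phi>
      unfolding cinner_scaleC_left cinner_scaleC_right complex_eq_iff by auto
    then show ?thesis by (simp only: op_adjoint_def mem_Collect_eq prod.case)
  qed
  also have "\<dots> \<longleftrightarrow> (\<forall>(x, u)\<in>?A. cinner u y = - cinner x v)" by blast
  finally show "(y, v) \<in> ?A \<longleftrightarrow> (\<forall>(x, u)\<in>?A. cinner u y = - cinner x v)" .
qed

text \<open>
  The description that defines \<open>exp_group D\<close> denotes something only because of existence and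
  uniqueness in Stone's theorem; this is where self-adjointness of \<open>D\<close> enters.
\<close>

theorem unitary_group_exp_group:
  assumes "self_adjoint D"
  shows "unitary_group (exp_group D)"
proof -
  interpret skew_adjoint "{(\<xi>, \<i> *\<^sub>C \<phi>) | \<xi> \<phi>. (\<xi>, \<phi>) \<in> D}"
    by (rule self_adjoint_imp_skew_adjoint[OF assms])
  have "\<exists>!U. unitary_group U \<and> generator U = {(\<xi>, \<i> *\<^sub>C \<phi>) | \<xi> \<phi>. (\<xi>, \<phi>) \<in> D}"
    by (rule unitary_group_exists, rule ex1I) (blast intro: unitary_group_unique)+
  from theI'[OF this] show ?thesis unfolding exp_group_def by blast
qed

section \<open>Weak and uniform differentiability\<close>

lemma blinfun_norm_le_cinner:
  fixes T :: "'a::chilbert_space \<Rightarrow>\<^sub>L 'a"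
  assumes "0 \<le> C" "\<And>\<xi> \<eta>. cmod (cinner (T \<xi>) \<eta>) \<le> C * norm \<xi> * norm \<eta>"
  shows "norm T \<le> C"
proof (rule norm_blinfun_bound[OF assms(1)])
  fix \<xi>
  have "norm (T \<xi>) * norm (T \<xi>) \<le> C * norm \<xi> * norm (T \<xi>)"
    using assms(2)[of \<xi> "T \<xi>"] unfolding cinner_self norm_of_real
    by (simp add: power2_eq_square)
  then show "norm (T \<xi>) \<le> C * norm \<xi>"
    using assms(1) mult_right_le_imp_le[of "norm (T \<xi>)" "norm (T \<xi>)" "C * norm \<xi>"]
    by (cases "T \<xi> = 0") auto
qed

lemma has_weak_D_derivative_unique:
  assumes "has_weak_D_derivative D a b" "has_weak_D_derivative D a c"
  shows "b = c"
proof (rule blinfun_eqI)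
  fix \<xi>
  define \<eta> where "\<eta> = b \<xi> - c \<xi>"
  define q where "q t = (1 / t) *\<^sub>R (alpha D t a - a)" for t
  have "((\<lambda>t. cinner ((q t - c) \<xi>) \<eta> - cinner ((q t - b) \<xi>) \<eta>) \<longlongrightarrow> 0 - 0) (at 0)"
    using assms unfolding has_weak_D_derivative_def q_def
    by (intro tendsto_diff) (rule tendsto_norm_zero_cancel, simp)+
  then have "((\<lambda>t::real. cinner \<eta> \<eta>) \<longlongrightarrow> 0) (at 0)"
    by (simp add: \<eta>_def blinfun.diff_left cinner.diff_left)
  then have "cinner \<eta> \<eta> = 0" by (simp add: tendsto_const_iff)
  then show "b \<xi> = c \<xi>" by (simp add: \<eta>_def cinner_self)
qed

lemma uniform_imp_weak_D_derivative:
  fixes a b :: "'a::chilbert_space \<Rightarrow>\<^sub>L 'a"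
  assumes "has_uniform_D_derivative D a b"
  shows "has_weak_D_derivative D a b"
  unfolding has_weak_D_derivative_def
proof (intro conjI allI)
  show "b \<in> bounded_ops" using assms by (simp add: has_uniform_D_derivative_def)
  fix \<xi> \<eta> :: 'a
  define q where "q t = (1 / t) *\<^sub>R (alpha D t a - a) - b" for t
  have "((\<lambda>t. norm (q t) * norm \<xi> * norm \<eta>) \<longlongrightarrow> 0 * norm \<xi> * norm \<eta>) (at 0)"
    using assms unfolding has_uniform_D_derivative_def q_def by (intro tendsto_intros) auto
  then have lim: "((\<lambda>t. norm (q t) * norm \<xi> * norm \<eta>) \<longlongrightarrow> 0) (at 0)"
    by simp
  have "cmod (cinner (q t \<xi>) \<eta>) \<le> norm (q t) * norm \<xi> * norm \<eta>" for t
    using cinner_Cauchy_Schwarz[of "q t \<xi>" \<eta>] mult_right_mono[OF norm_blinfun[of "q t" \<xi>], of "norm \<eta>"]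
    by simp
  then have "((\<lambda>t. cmod (cinner (q t \<xi>) \<eta>)) \<longlongrightarrow> 0) (at 0)"
    by (intro Lim_null_comparison[OF _ lim] always_eventually) simp
  then show "((\<lambda>t. cmod (cinner (((1 / t) *\<^sub>R (alpha D t a - a) - b) \<xi>) \<eta>)) \<longlongrightarrow> 0) (at 0)"
    by (simp add: q_def)
qed

lemma delta_w_eq:
  assumes "has_weak_D_derivative D a b"
  shows "delta_w D a = b"
  unfolding delta_w_def
  by (rule the_equality, rule assms, rule has_weak_D_derivative_unique[OF _ assms])

lemma delta_u_eq:
  assumes "has_uniform_D_derivative D a b"
  shows "delta_u D a = b"
  unfolding delta_u_def
  by (rule the_equality, rule assms,
      rule has_weak_D_derivative_unique[OF uniform_imp_weak_D_derivative
        uniform_imp_weak_D_derivative[OF assms]])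

locale conjugation_flow =
  fixes D :: "('a::chilbert_space \<times> 'a) set"
  assumes group: "unitary_group (exp_group D)"
begin

lemma cinner_alpha:
  "cinner (alpha D t a \<xi>) \<eta> = cinner (a (exp_group D (- t) \<xi>)) (exp_group D (- t) \<eta>)"
  by (simp add: alpha_def unitary_group_adjoint[OF group])

lemma alpha_zero: "alpha D 0 a = a"
  using group by (intro blinfun_eqI) (simp add: alpha_def unitary_group_def)

lemma cmod_cinner_alpha_le: "cmod (cinner (alpha D t a \<xi>) \<eta>) \<le> norm a * norm \<xi> * norm \<eta>"
proof -
  have "cmod (cinner (alpha D t a \<xi>) \<eta>)
      \<le> norm (a (exp_group D (- t) \<xi>)) * norm (exp_group D (- t) \<eta>)"
    unfolding cinner_alpha by (rule cinner_Cauchy_Schwarz)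
  also have "\<dots> \<le> norm a * norm \<xi> * norm \<eta>"
    using norm_blinfun[of a "exp_group D (- t) \<xi>"]
    by (simp add: unitary_group_norm[OF group] mult_right_mono)
  finally show ?thesis .
qed

lemma alpha_add: "alpha D (t + h) a \<xi> = exp_group D t (alpha D h a (exp_group D (- t) \<xi>))"
proof -
  have "exp_group D (- (t + h)) \<xi> = exp_group D (- h) (exp_group D (- t) \<xi>)"
    using unitary_group_add[OF group, of "- h" "- t" \<xi>] by (simp add: add.commute[of t])
  then show ?thesis by (simp add: alpha_def unitary_group_add[OF group])
qed

text \<open>
  The definition of the weak derivative only speaks about the time \<open>0\<close>; invariance of the inner
  product under the group moves it to every other time.
\<close>

lemma weak_D_derivative_imp_has_vector_derivative:
  assumes "has_weak_D_derivative D a b"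
  shows "((\<lambda>t. cinner (alpha D t a \<xi>) \<eta>) has_vector_derivative cinner (alpha D t b \<xi>) \<eta>) (at t)"
  unfolding has_vector_derivative_def has_derivative_at
proof
  show "bounded_linear (\<lambda>h. h *\<^sub>R cinner (alpha D t b \<xi>) \<eta>)"
    by (rule bounded_linear_scaleR_left)
  define \<xi>' where "\<xi>' = exp_group D (- t) \<xi>"
  define \<eta>' where "\<eta>' = exp_group D (- t) \<eta>"
  have "((\<lambda>h. cmod (cinner (((1 / h) *\<^sub>R (alpha D h a - a) - b) \<xi>') \<eta>')) \<longlongrightarrow> 0) (at 0)"
    using assms by (simp add: has_weak_D_derivative_def)
  moreover have "\<forall>\<^sub>F h in at 0. cmod (cinner (((1 / h) *\<^sub>R (alpha D h a - a) - b) \<xi>') \<eta>')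
    = norm (cinner (alpha D (t + h) a \<xi>) \<eta> - cinner (alpha D t a \<xi>) \<eta>
        - h *\<^sub>R cinner (alpha D t b \<xi>) \<eta>) / norm h"
    unfolding eventually_at_filter
  proof (intro always_eventually allI impI)
    fix h :: real assume "h \<noteq> 0"
    then have "cinner (((1 / h) *\<^sub>R (alpha D h a - a) - b) \<xi>') \<eta>'
      = (1 / h) *\<^sub>R (cinner (alpha D h a \<xi>') \<eta>' - cinner (a \<xi>') \<eta>' - h *\<^sub>R cinner (b \<xi>') \<eta>')"
      by (simp add: blinfun.diff_left blinfun.scaleR_left cinner.diff_left cinner_scaleR_left
          scaleR_diff_right)
    also have "cinner (alpha D h a \<xi>') \<eta>' = cinner (alpha D (t + h) a \<xi>) \<eta>"
      by (simp add: alpha_add unitary_group_adjoint[OF group] \<xi>'_def \<eta>'_def)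
    finally show "cmod (cinner (((1 / h) *\<^sub>R (alpha D h a - a) - b) \<xi>') \<eta>')
      = norm (cinner (alpha D (t + h) a \<xi>) \<eta> - cinner (alpha D t a \<xi>) \<eta>
          - h *\<^sub>R cinner (alpha D t b \<xi>) \<eta>) / norm h"
      by (simp add: cinner_alpha[of t] \<xi>'_def \<eta>'_def)
  qed
  ultimately show "(\<lambda>h. norm (cinner (alpha D (t + h) a \<xi>) \<eta> - cinner (alpha D t a \<xi>) \<eta>
        - h *\<^sub>R cinner (alpha D t b \<xi>) \<eta>) / norm h) \<midarrow>0\<rightarrow> 0"
    by (rule Lim_transform_eventually)
qed

text \<open>
  The matrix coefficients of \<open>\<alpha>\<^sub>t(a)\<close> have derivatives bounded by \<open>\<parallel>b\<parallel>\<close>, uniformly on the unit ball,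
  so the mean value inequality turns weak differentiability into norm continuity.
\<close>

lemma norm_alpha_diff_le:
  assumes "has_weak_D_derivative D a b"
  shows "norm (alpha D t a - a) \<le> norm b * \<bar>t\<bar>"
proof (rule blinfun_norm_le_cinner)
  fix \<xi> \<eta>
  have "norm (cinner (alpha D t a \<xi>) \<eta> - cinner (alpha D 0 a \<xi>) \<eta>) \<le> norm b * norm \<xi> * norm \<eta> * \<bar>t\<bar>"
    by (rule vector_derivative_bound[OF weak_D_derivative_imp_has_vector_derivative[OF assms]
          cmod_cinner_alpha_le])
  then show "cmod (cinner ((alpha D t a - a) \<xi>) \<eta>) \<le> norm b * \<bar>t\<bar> * norm \<xi> * norm \<eta>"
    by (simp add: alpha_zero blinfun.diff_left cinner.diff_left mult_ac)
qed simp

text \<open>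
  A Taylor estimate of second order: the remainder has matrix coefficients with derivative
  \<open>\<langle>(\<alpha>\<^sub>s(b) - b) \<xi>, \<eta>\<rangle>\<close>, to which the Lipschitz bound for \<open>b\<close> applies.
\<close>

lemma norm_alpha_taylor_le:
  assumes "has_weak_D_derivative D a b" "has_weak_D_derivative D b c"
  shows "norm (alpha D t a - a - t *\<^sub>R b) \<le> norm c * \<bar>t\<bar> * \<bar>t\<bar>"
proof (rule blinfun_norm_le_cinner)
  fix \<xi> \<eta>
  define f where "f s = cinner (alpha D s a \<xi>) \<eta> - s *\<^sub>R cinner (b \<xi>) \<eta>" for s
  have "norm (f t - f 0) \<le> norm c * \<bar>t\<bar> * norm \<xi> * norm \<eta> * \<bar>t\<bar>"
  proof (rule vector_derivative_bound)
    fix s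
    have "((\<lambda>s. s *\<^sub>R cinner (b \<xi>) \<eta>) has_vector_derivative cinner (b \<xi>) \<eta>) (at s)"
      by (auto intro!: derivative_eq_intros)
    from has_vector_derivative_diff[OF weak_D_derivative_imp_has_vector_derivative[OF assms(1)] this]
    show "(f has_vector_derivative cinner ((alpha D s b - b) \<xi>) \<eta>) (at s)"
      by (simp add: f_def[abs_def] blinfun.diff_left cinner.diff_left)
    assume "\<bar>s\<bar> \<le> \<bar>t\<bar>"
    have "cmod (cinner ((alpha D s b - b) \<xi>) \<eta>) \<le> norm ((alpha D s b - b) \<xi>) * norm \<eta>"
      by (rule cinner_Cauchy_Schwarz)
    also have "\<dots> \<le> norm (alpha D s b - b) * norm \<xi> * norm \<eta>"
      by (intro mult_right_mono norm_blinfun) auto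
    also have "\<dots> \<le> norm c * \<bar>s\<bar> * norm \<xi> * norm \<eta>"
      by (intro mult_right_mono norm_alpha_diff_le assms) auto
    also have "\<dots> \<le> norm c * \<bar>t\<bar> * norm \<xi> * norm \<eta>"
      using \<open>\<bar>s\<bar> \<le> \<bar>t\<bar>\<close> by (intro mult_right_mono mult_left_mono) auto
    finally show "norm (cinner ((alpha D s b - b) \<xi>) \<eta>) \<le> norm c * \<bar>t\<bar> * norm \<xi> * norm \<eta>" .
  qed
  moreover have "f t - f 0 = cinner ((alpha D t a - a - t *\<^sub>R b) \<xi>) \<eta>"
    by (simp add: f_def alpha_zero blinfun.diff_left blinfun.scaleR_left cinner.diff_left
        cinner_scaleR_left)
  ultimately show "cmod (cinner ((alpha D t a - a - t *\<^sub>R b) \<xi>) \<eta>)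
      \<le> norm c * \<bar>t\<bar> * \<bar>t\<bar> * norm \<xi> * norm \<eta>"
    by (simp add: mult_ac)
qed simp

lemma twice_weak_imp_uniform_D_derivative:
  assumes "has_weak_D_derivative D a b" "has_weak_D_derivative D b c"
  shows "has_uniform_D_derivative D a b"
  unfolding has_uniform_D_derivative_def
proof
  show "b \<in> bounded_ops" using assms(1) by (simp add: has_weak_D_derivative_def)
  have "\<forall>\<^sub>F t in at 0. norm ((1 / t) *\<^sub>R (alpha D t a - a) - b) \<le> norm c * \<bar>t\<bar>"
    unfolding eventually_at_filter
  proof (intro always_eventually allI impI)
    fix t :: real assume "t \<noteq> 0"
    then have "(1 / t) *\<^sub>R (alpha D t a - a) - b = (1 / t) *\<^sub>R (alpha D t a - a - t *\<^sub>R b)"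
      by (simp add: scaleR_diff_right)
    then have "norm ((1 / t) *\<^sub>R (alpha D t a - a) - b) = norm (alpha D t a - a - t *\<^sub>R b) / \<bar>t\<bar>"
      by simp
    also have "\<dots> \<le> norm c * \<bar>t\<bar>"
      using norm_alpha_taylor_le[OF assms, of t] \<open>t \<noteq> 0\<close> by (simp add: divide_le_eq)
    finally show "norm ((1 / t) *\<^sub>R (alpha D t a - a) - b) \<le> norm c * \<bar>t\<bar>" .
  qed
  moreover have "((\<lambda>t. norm c * \<bar>t\<bar>) \<longlongrightarrow> 0) (at 0)"
    using tendsto_mult_right_zero[OF tendsto_rabs_zero[OF tendsto_ident_at[of "0::real" UNIV]]] .
  ultimately show "((\<lambda>t. norm ((1 / t) *\<^sub>R (alpha D t a - a) - b)) \<longlongrightarrow> 0) (at 0)"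
    by (simp add: Lim_null_comparison)
qed

text \<open>
  A uniform derivative is a weak one, so by uniqueness the iterates of the two derivations on \<open>a\<close>
  agree as long as the uniform ones exist. The derivative of order \<open>j < n\<close> is uniformly
  differentiable since weak derivatives exist up to order \<open>j + 2 \<le> n + 1\<close>.
\<close>

lemma times_weakly_imp_times_uniformly:
  assumes "times_weakly_D_differentiable (n + 1) D a"
  shows "times_uniformly_D_differentiable n D a"
proof -
  have weak: "(delta_w D ^^ j) a \<in> bounded_ops \<and>
      has_weak_D_derivative D ((delta_w D ^^ j) a) ((delta_w D ^^ Suc j) a)" if "j \<le> n" for j
  proof -
    have "weakly_D_differentiable D ((delta_w D ^^ j) a)"
      using assms that by (simp add: times_weakly_D_differentiable_def)
    then obtain b where "(delta_w D ^^ j) a \<in> bounded_ops" "has_weak_D_derivative D ((delta_w D ^^ j) a) b"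
      by (auto simp: weakly_D_differentiable_def)
    then show ?thesis using delta_w_eq[of D "(delta_w D ^^ j) a" b] by simp
  qed
  have unif: "has_uniform_D_derivative D ((delta_w D ^^ j) a) ((delta_w D ^^ Suc j) a)" if "j < n" for j
    using weak[of j] weak[of "Suc j"] that
    by (intro twice_weak_imp_uniform_D_derivative[where c="(delta_w D ^^ Suc (Suc j)) a"]) auto
  have eq: "(delta_u D ^^ j) a = (delta_w D ^^ j) a" if "j \<le> n" for j
    using that
  proof (induction j)
    case (Suc j)
    then show ?case using delta_u_eq[OF unif[of j]] by simp
  qed simp
  show ?thesis
    unfolding times_uniformly_D_differentiable_def uniformly_D_differentiable_def
  proof (intro allI impI conjI exI)
    fix j assume "j < n"
    show "(delta_u D ^^ j) a \<in> bounded_ops"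
      using weak[of j] eq[of j] \<open>j < n\<close> by simp
    show "has_uniform_D_derivative D ((delta_u D ^^ j) a) ((delta_w D ^^ Suc j) a)"
      using unif[of j] eq[of j] \<open>j < n\<close> by simp
  qed
qed

end

theorem corollary4p2:
  fixes D :: "('a::chilbert_space \<times> 'a) set"
    and a :: "'a \<Rightarrow>\<^sub>L 'a"
    and n :: nat
  assumes "self_adjoint D"
    and "n \<ge> 1"
    and "a \<in> bounded_ops"
    and "times_weakly_D_differentiable (n + 1) D a"
  shows "times_uniformly_D_differentiable n D a"
proof -
  interpret conjugation_flow D
    by standard (rule unitary_group_exp_group[OF assms(1)])
  show ?thesis by (rule times_weakly_imp_times_uniformly[OF assms(4)])
qed

end
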